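(* Assume $\mathbb{E}[\log^2\xi]<\infty$, $\mathbb{E}[\log\eta]<\infty$, $$\mathbb{P}\{\lambda_p(\xi)>0\}>0\quad\text{for every }p\in\mathcal{P},$$ and the following two conditions: $$\sum_{p\in\mathcal{P}}\mathbb{E}\left[((\lambda_p(\eta)-\lambda_p(\xi))^{+})^2\right]\log p<\infty$$ and $$\sum_{p\in\mathcal{P}_2(n)}\mathbb{E}\left[(\lambda_p(\eta)-\lambda_p(\xi))^{+}\right]\log p=o(n^{-1/2}),\quad n\to\infty,$$ where $\mathcal{P}_2(n):=\mathcal{P}\setminus\mathcal{P}_1(n)$ and $\mathcal{P}_1(n):=\{p\in\mathcal{P}:\mathbb{P}\{\lambda_p(\xi)>0\}\ge n^{-1/2}\}$. For $n\in\mathbb{N}$ let $L_n:=\mathrm{LCM}(\{\Theta_1,\Theta_2,\ldots,\Theta_n\})$. Then $$\left(\frac{\log L_{\lfloor tu\rfloor}-\mu_\xi tu}{t^{1/2}}\right)_{u\ge0}\longrightarrow(\sigma_\xi W(u))_{u\ge0},\quad t\to\infty,$$ in the sense of weak convergence of finite-dimensional distributions, where $\mu_\xi=\mathbb{E}[\log\xi]<\infty$, $\sigma_\xi^2=\mathrm{Var}[\log\xi]$ and $(W(u))_{u\ge0}$ is a standard Brownian motion.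
   Context: $\mathbb{N}=\{1,2,\ldots\}$. $(\xi_1,\eta_1),(\xi_2,\eta_2),\ldots$ are independent copies of an $\mathbb{N}^2$-valued random vector $(\xi,\eta)$ with arbitrarily dependent components. $\mathcal{P}$ is the set of prime numbers, and for $n\in\mathbb{N}$, $p\in\mathcal{P}$, $\lambda_p(n)$ is the multiplicity of $p$ in the prime decomposition of $n$, so $n=\prod_{p\in\mathcal{P}}p^{\lambda_p(n)}$. Put $\Pi_0=1$, $\Pi_k=\xi_1\cdots\xi_k$, and $\Theta_k=\Pi_{k-1}\cdot\eta_k$ for $k\in\mathbb{N}$. $\mathrm{LCM}(A)$ is the least common multiple of a finite set $A\subset\mathbb{N}$, with $\mathrm{LCM}(\varnothing)=1$ (so $L_0=1$). $x^+=\max(x,0)$. *)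

theory Defs
  imports "HOL-Probability.Probability" "HOL-Computational_Algebra.Primes"
begin

(* \<nat> = {1, 2, ...}: a random variable M \<rightarrow>\<^sub>M posnat2 is a measurable pair of nat-valued functions
   that are both positive on the whole of space M. *)
abbreviation posnat2 :: "(nat \<times> nat) measure" where
  "posnat2 \<equiv> count_space ({1..} \<times> {1..})"

definition Pi_walk :: "(nat \<Rightarrow> 'a \<Rightarrow> nat) \<Rightarrow> nat \<Rightarrow> 'a \<Rightarrow> nat" where
  "Pi_walk \<xi> k \<omega> = (\<Prod>i\<in>{1..k}. \<xi> i \<omega>)"

(* Only meaningful for k \<ge> 1. *)
definition Theta :: "(nat \<Rightarrow> 'a \<Rightarrow> nat) \<Rightarrow> (nat \<Rightarrow> 'a \<Rightarrow> nat) \<Rightarrow> nat \<Rightarrow> 'a \<Rightarrow> nat" where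
  "Theta \<xi> \<eta> k \<omega> = Pi_walk \<xi> (k - 1) \<omega> * \<eta> k \<omega>"

definition L_lcm :: "(nat \<Rightarrow> 'a \<Rightarrow> nat) \<Rightarrow> (nat \<Rightarrow> 'a \<Rightarrow> nat) \<Rightarrow> nat \<Rightarrow> 'a \<Rightarrow> nat" where
  "L_lcm \<xi> \<eta> n \<omega> = Lcm ((\<lambda>k. Theta \<xi> \<eta> k \<omega>) ` {1..n})"

definition excess :: "nat \<Rightarrow> ('a \<Rightarrow> nat) \<Rightarrow> ('a \<Rightarrow> nat) \<Rightarrow> 'a \<Rightarrow> real" where
  "excess p \<xi> \<eta> \<omega> = max (real (multiplicity p (\<eta> \<omega>)) - real (multiplicity p (\<xi> \<omega>))) 0"

definition primes1 :: "'a measure \<Rightarrow> ('a \<Rightarrow> nat) \<Rightarrow> nat \<Rightarrow> nat set" where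
  "primes1 M \<xi> n =
     {p. prime p \<and> measure M {\<omega> \<in> space M. multiplicity p (\<xi> \<omega>) > 0} \<ge> real n powr (- 1 / 2)}"

definition primes2 :: "'a measure \<Rightarrow> ('a \<Rightarrow> nat) \<Rightarrow> nat \<Rightarrow> nat set" where
  "primes2 M \<xi> n = {p. prime p} - primes1 M \<xi> n"

definition weakly_converges ::
    "('i \<Rightarrow> 'b::topological_space measure) \<Rightarrow> 'b measure \<Rightarrow> 'i filter \<Rightarrow> bool" where
  "weakly_converges \<mu> \<nu> F \<longleftrightarrow>
     (\<forall>f :: 'b \<Rightarrow> real. continuous_on UNIV f \<and> bounded (range f) \<longrightarrow>
        ((\<lambda>i. integral\<^sup>L (\<mu> i) f) \<longlongrightarrow> integral\<^sup>L \<nu> f) F)"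

(* The law of (X (u 1), ..., X (u d)) with d = CARD('n). *)
definition fdd :: "'a measure \<Rightarrow> (real \<Rightarrow> 'a \<Rightarrow> real) \<Rightarrow> real ^ 'n \<Rightarrow> (real ^ 'n) measure" where
  "fdd M X u = distr M borel (\<lambda>\<omega>. \<chi> i. X (u $ i) \<omega>)"

definition standard_brownian_motion :: "'b measure \<Rightarrow> (real \<Rightarrow> 'b \<Rightarrow> real) \<Rightarrow> bool" where
  "standard_brownian_motion N W \<longleftrightarrow>
     prob_space N \<and>
     (\<forall>u\<ge>0. W u \<in> borel_measurable N) \<and>
     (AE \<omega> in N. W 0 \<omega> = 0) \<and>
     (\<forall>(s :: nat \<Rightarrow> real) n. 0 \<le> s 0 \<and> mono s \<longrightarrow>
        prob_space.indep_vars N (\<lambda>_. borel) (\<lambda>i \<omega>. W (s (Suc i)) \<omega> - W (s i) \<omega>) {..<n}) \<and>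
     (\<forall>s u. 0 \<le> s \<and> s < u \<longrightarrow>
        distributed N lborel (\<lambda>\<omega>. W u \<omega> - W s \<omega>) (normal_density 0 (sqrt (u - s)))) \<and>
     (AE \<omega> in N. continuous_on {0..} (\<lambda>u. W u \<omega>))"

end

theory Submission
  imports Defs
begin

text \<open>
  The least common multiple \<open>L\<^sub>n\<close> behaves like the product \<open>\<Pi>\<^sub>n = \<xi>\<^sub>1 \<cdots> \<xi>\<^sub>n\<close>: the claim is that
  \<open>ln L\<^sub>n - ln \<Pi>\<^sub>n\<close> is \<open>o(sqrt n)\<close> in mean. Since \<open>ln \<Pi>\<^sub>n\<close> is a sum of independent identically
  distributed variables with finite variance, the limit is then that of a random walk.

  The gap is bounded below by \<open>- ln \<xi>\<^sub>n\<close>, because \<open>\<Theta>\<^sub>n\<close> is a multiple of \<open>\<Pi>\<^sub>n\<^sub>-\<^sub>1\<close>. For the upper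
  bound, fix a prime \<open>p\<close>. The term \<open>\<Theta>\<^sub>k\<close> contains more factors \<open>p\<close> than \<open>\<Pi>\<^sub>n\<close> only if the surplus
  \<open>(\<lambda>\<^sub>p(\<eta>\<^sub>k) - \<lambda>\<^sub>p(\<xi>\<^sub>k))\<^sup>+\<close> is not used up by the later factors \<open>\<xi>\<^sub>k\<^sub>+\<^sub>1, \<dots>, \<xi>\<^sub>n\<close>
  (\<open>multiplicity_L_lcm_le\<close>). Each of these factors reduces a positive surplus by at least 1 with
  probability \<open>q\<^sub>p = P(p dvd \<xi>)\<close>, so the values of an initial surplus \<open>x\<close> until it is
  used up add up to at most \<open>x\<^sup>2 / q\<^sub>p\<close> in expectation; a quadratic Lyapunov function makes this rigorous
  (\<open>residual_drift\<close>, \<open>sum_residual_le_second_moment\<close>). The contribution of \<open>p\<close> to the expected gap is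
  therefore at most \<open>ln p\<close> times the minimum of the second moment of the surplus over \<open>q\<^sub>p\<close> and \<open>n\<close>
  times its first moment. The first of these bounds is used where \<open>q\<^sub>p \<ge> n\<^sup>-\<^sup>1\<^sup>/\<^sup>2\<close>: after division by
  \<open>sqrt n\<close> it is dominated by a summable sequence and tends to 0 for each \<open>p\<close>, since \<open>q\<^sub>p > 0\<close>. The
  second is used for the other primes, where the second excess condition is exactly what is
  needed (\<open>tendsto_expected_gap\<close>).

  For the random walk (\<open>iid_sums_fdd_converge\<close>) the increments over disjoint blocks are independent,
  and Skorohod's representation of the one-dimensional central limit theorem, taken independently for
  each block, yields joint convergence. A version of Slutsky's theorem in Euclidean space
  (\<open>weakly_converges_perturb\<close>) transfers the limit to \<open>ln L\<^sub>n\<close>.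
\<close>

section \<open>Perturbation of weakly convergent families\<close>

lemma borel_measurable_vec_lambda [measurable (raw)]:
  fixes f :: "'n::finite \<Rightarrow> 'a \<Rightarrow> real"
  assumes "\<And>i. f i \<in> borel_measurable M"
  shows "(\<lambda>x. \<chi> i. f i x) \<in> borel_measurable M"
  by (rule borel_measurable_euclidean_space[THEN iffD2]) (use assms in \<open>auto simp: Basis_vec_def inner_axis\<close>)

lemma (in prob_space) integrable_bounded:
  fixes f :: "'b::topological_space \<Rightarrow> real"
  assumes "f \<in> borel_measurable borel" "X \<in> borel_measurable M" "\<And>x. \<bar>f x\<bar> \<le> B"
  shows "integrable M (\<lambda>x. f (X x))"
  by (rule integrable_const_bound[where B=B]) (use assms in \<open>auto intro!: AE_I2\<close>)

text \<open>Slutsky's theorem. A bounded continuous \<open>f\<close> need not be uniformly continuous, so closeness of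
  \<open>X\<close> and \<open>V\<close> is useful only where \<open>V\<close> stays in a fixed ball. That \<open>V\<close> rarely leaves a large ball
  follows by testing the weak convergence against a continuous cutoff, because the limit law is tight.\<close>

lemma weakly_converges_perturb:
  fixes V X :: "'i \<Rightarrow> 'a \<Rightarrow> 'b::euclidean_space" and \<nu> :: "'b measure"
  assumes "prob_space M" "prob_space \<nu>" and sets: "sets \<nu> = sets borel"
    and V [measurable]: "\<And>i. V i \<in> borel_measurable M"
    and X [measurable]: "\<And>i. X i \<in> borel_measurable M"
    and conv: "weakly_converges (\<lambda>i. distr M borel (V i)) \<nu> F"
    and close: "\<And>\<delta>. \<delta> > 0 \<Longrightarrow> ((\<lambda>i. measure M {\<omega>\<in>space M. \<delta> \<le> dist (X i \<omega>) (V i \<omega>)}) \<longlongrightarrow> 0) F"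
  shows "weakly_converges (\<lambda>i. distr M borel (X i)) \<nu> F"
  unfolding weakly_converges_def
proof (intro allI impI)
  interpret M: prob_space M by fact
  interpret \<nu>: prob_space \<nu> by fact
  note sets [measurable_cong]
  fix f :: "'b \<Rightarrow> real" assume f: "continuous_on UNIV f \<and> bounded (range f)"
  then have contf: "continuous_on UNIV f" by simp
  have fm [measurable]: "f \<in> borel_measurable borel"
    using contf by (rule borel_measurable_continuous_onI)
  from f obtain B where B: "B > 0" "\<And>x. \<bar>f x\<bar> \<le> B"
    unfolding bounded_pos by auto
  define g where "g K v = min 1 (max 0 (norm v - real K))" for K and v :: 'b
  have contg: "continuous_on UNIV (g K)" for K
    unfolding g_def by (intro continuous_intros)
  have [measurable]: "g K \<in> borel_measurable borel" for K
    using contg by (rule borel_measurable_continuous_onI)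
  have g01: "0 \<le> g K v" "g K v \<le> 1" for K v
    by (auto simp: g_def)
  then have gabs: "\<bar>g K v\<bar> \<le> 1" for K v
    by (simp add: abs_of_nonneg)
  then have gbdd: "bounded (range (g K))" for K
    unfolding bounded_iff by (intro exI[of _ 1]) auto
  have gint: "(\<lambda>K. integral\<^sup>L \<nu> (g K)) \<longlonglongrightarrow> integral\<^sup>L \<nu> (\<lambda>_. 0)"
  proof (rule integral_dominated_convergence[where w="\<lambda>_. 1"])
    show "AE x in \<nu>. (\<lambda>K. g K x) \<longlonglongrightarrow> 0"
    proof (rule AE_I2)
      fix x :: 'b
      obtain K0 where "norm x \<le> real K0" using real_arch_simple by blast
      then have "eventually (\<lambda>K. g K x = 0) sequentially"
        by (intro eventually_sequentiallyI[of K0]) (auto simp: g_def)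
      then show "(\<lambda>K. g K x) \<longlonglongrightarrow> 0" by (rule tendsto_eventually)
    qed
  qed (use gabs in auto)
  have diff0: "((\<lambda>i. (\<integral>\<omega>. f (X i \<omega>) \<partial>M) - (\<integral>\<omega>. f (V i \<omega>) \<partial>M)) \<longlongrightarrow> 0) F"
  proof (rule tendstoI)
    fix \<epsilon> :: real assume "\<epsilon> > 0"
    define \<eta> where "\<eta> = \<epsilon> / (8 * B)"
    have "\<eta> > 0" using \<open>\<epsilon> > 0\<close> B by (simp add: \<eta>_def)
    have "eventually (\<lambda>K. integral\<^sup>L \<nu> (g K) < \<eta>) sequentially"
      using order_tendstoD(2)[OF gint, of \<eta>] \<open>\<eta> > 0\<close> by simp
    then obtain K where K: "integral\<^sup>L \<nu> (g K) < \<eta>"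
      by (auto simp: eventually_sequentially)
    have "((\<lambda>i. integral\<^sup>L (distr M borel (V i)) (g K)) \<longlongrightarrow> integral\<^sup>L \<nu> (g K)) F"
      using conv contg[of K] gbdd unfolding weakly_converges_def by blast
    from order_tendstoD(2)[OF this K]
    have ev1: "eventually (\<lambda>i. (\<integral>\<omega>. g K (V i \<omega>) \<partial>M) < \<eta>) F"
      by (simp add: integral_distr)
    \<comment> \<open>Radius \<open>K + 2\<close>: \<open>V\<close> is considered up to \<open>K + 1\<close>, and \<open>X\<close> within distance 1 of it.\<close>
    have "uniformly_continuous_on (cball 0 (real K + 2)) f"
      by (rule compact_uniformly_continuous[OF continuous_on_subset[OF contf]]) auto
    then obtain d where d: "d > 0" "\<And>x x'. x \<in> cball 0 (real K + 2) \<Longrightarrow> x' \<in> cball 0 (real K + 2)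
        \<Longrightarrow> dist x' x < d \<Longrightarrow> dist (f x') (f x) < \<epsilon>/4"
      unfolding uniformly_continuous_on_def using \<open>\<epsilon> > 0\<close> by (metis \<open>\<epsilon> > 0\<close> zero_less_divide_iff zero_less_numeral)
    define \<delta> where "\<delta> = min d 1"
    have "\<delta> > 0" using d by (simp add: \<delta>_def)
    have ev2: "eventually (\<lambda>i. measure M {\<omega>\<in>space M. \<delta> \<le> dist (X i \<omega>) (V i \<omega>)} < \<eta>) F"
      using order_tendstoD(2)[OF close[OF \<open>\<delta> > 0\<close>] \<open>\<eta> > 0\<close>] .
    show "eventually (\<lambda>i. dist ((\<integral>\<omega>. f (X i \<omega>) \<partial>M) - (\<integral>\<omega>. f (V i \<omega>) \<partial>M)) 0 < \<epsilon>) F"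
      using ev1 ev2
    proof eventually_elim
      case (elim i)
      let ?A = "{\<omega>\<in>space M. \<delta> \<le> dist (X i \<omega>) (V i \<omega>)}"
      have intf: "integrable M (\<lambda>\<omega>. f (X i \<omega>))" "integrable M (\<lambda>\<omega>. f (V i \<omega>))"
        by (rule M.integrable_bounded[OF fm _ B(2)]; measurable)+
      have intg: "integrable M (\<lambda>\<omega>. g K (V i \<omega>))"
        by (rule M.integrable_bounded[OF _ _ gabs]; measurable)
      have int\<chi>: "integrable M (indicat_real ?A)"
        by (rule integrable_real_indicator) (auto simp: M.emeasure_eq_measure)
      have pw: "\<bar>f (X i \<omega>) - f (V i \<omega>)\<bar> \<le> \<epsilon>/4 + 2*B * g K (V i \<omega>) + 2*B * indicator ?A \<omega>"
        if "\<omega> \<in> space M" for \<omega>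
      proof -
        have le2B: "\<bar>f (X i \<omega>) - f (V i \<omega>)\<bar> \<le> 2*B"
          using B(2)[of "X i \<omega>"] B(2)[of "V i \<omega>"] by linarith
        have gn: "0 \<le> 2*B * g K (V i \<omega>)" using B g01 by simp
        consider "\<omega> \<in> ?A" | "norm (V i \<omega>) > real K + 1" | "\<omega> \<notin> ?A" "norm (V i \<omega>) \<le> real K + 1"
          by fastforce
        then show ?thesis
        proof cases
          case 1 then show ?thesis using le2B gn \<open>\<epsilon> > 0\<close> by simp
        next
          case 2 then have "g K (V i \<omega>) = 1" by (simp add: g_def)
          then show ?thesis using le2B B(1) \<open>\<epsilon> > 0\<close> by (simp add: indicator_def)
        next
          case 3
          then have dd: "dist (X i \<omega>) (V i \<omega>) < \<delta>" using that by simp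
          have "norm (X i \<omega>) \<le> norm (V i \<omega>) + dist (X i \<omega>) (V i \<omega>)"
            by (metis dist_norm norm_triangle_sub add.commute)
          then have "dist (f (X i \<omega>)) (f (V i \<omega>)) < \<epsilon>/4"
            using 3 dd by (intro d) (auto simp: \<delta>_def dist_norm)
          then show ?thesis using gn 3 by (simp add: dist_norm)
        qed
      qed
      have "\<bar>(\<integral>\<omega>. f (X i \<omega>) \<partial>M) - (\<integral>\<omega>. f (V i \<omega>) \<partial>M)\<bar> = \<bar>\<integral>\<omega>. f (X i \<omega>) - f (V i \<omega>) \<partial>M\<bar>"
        using intf by simp
      also have "\<dots> \<le> (\<integral>\<omega>. \<bar>f (X i \<omega>) - f (V i \<omega>)\<bar> \<partial>M)"
        by (rule integral_abs_bound)
      also have "\<dots> \<le> (\<integral>\<omega>. \<epsilon>/4 + 2*B * g K (V i \<omega>) + 2*B * indicator ?A \<omega> \<partial>M)"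
        using pw
        by (intro integral_mono integrable_abs Bochner_Integration.integrable_diff
            Bochner_Integration.integrable_add integrable_mult_right M.integrable_const intf intg int\<chi>)
      also have "\<dots> = \<epsilon>/4 + 2*B * (\<integral>\<omega>. g K (V i \<omega>) \<partial>M) + 2*B * measure M ?A"
        using intg int\<chi> by (simp add: M.prob_space)
      also have "\<dots> < \<epsilon>/4 + 2*B*\<eta> + 2*B*\<eta>"
        using elim B(1) by (intro add_strict_mono add_strict_left_mono mult_strict_left_mono) auto
      also have "\<dots> \<le> \<epsilon>"
        using B(1) \<open>\<epsilon> > 0\<close> by (simp add: \<eta>_def)
      finally show ?case by simp
    qed
  qed
  have "((\<lambda>i. integral\<^sup>L (distr M borel (V i)) f) \<longlongrightarrow> integral\<^sup>L \<nu> f) F"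
    using conv f unfolding weakly_converges_def by blast
  then have "((\<lambda>i. \<integral>\<omega>. f (V i \<omega>) \<partial>M) \<longlongrightarrow> integral\<^sup>L \<nu> f) F"
    by (simp add: integral_distr)
  from tendsto_add[OF diff0 this]
  show "((\<lambda>i. integral\<^sup>L (distr M borel (X i)) f) \<longlongrightarrow> integral\<^sup>L \<nu> f) F"
    by (simp add: integral_distr)
qed

section \<open>Joint laws of independent families\<close>

lemma distr_indep_vars_cong:
  assumes "prob_space M" "prob_space Q" "J \<noteq> {}"
    and X: "prob_space.indep_vars M N X J" and Z: "prob_space.indep_vars Q N Z J"
    and eq: "\<And>j. j \<in> J \<Longrightarrow> distr M (N j) (X j) = distr Q (N j) (Z j)"
  shows "distr M (PiM J N) (\<lambda>\<omega>. \<lambda>j\<in>J. X j \<omega>) = distr Q (PiM J N) (\<lambda>\<omega>. \<lambda>j\<in>J. Z j \<omega>)"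
proof -
  interpret M: prob_space M by fact
  interpret Q: prob_space Q by fact
  have "distr M (PiM J N) (\<lambda>\<omega>. \<lambda>j\<in>J. X j \<omega>) = PiM J (\<lambda>j. distr M (N j) (X j))"
    using X M.indep_vars_iff_distr_eq_PiM'[OF \<open>J \<noteq> {}\<close>, where M'=N and X=X] by (auto simp: M.indep_vars_def)
  also have "\<dots> = PiM J (\<lambda>j. distr Q (N j) (Z j))"
    using eq by (intro PiM_cong) auto
  also have "\<dots> = distr Q (PiM J N) (\<lambda>\<omega>. \<lambda>j\<in>J. Z j \<omega>)"
    using Z Q.indep_vars_iff_distr_eq_PiM'[OF \<open>J \<noteq> {}\<close>, where M'=N and X=Z] by (auto simp: Q.indep_vars_def)
  finally show ?thesis .
qed

lemma indep_vars_PiM_coordinates: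
  assumes "\<And>j. j \<in> J \<Longrightarrow> prob_space (P j)" "J \<noteq> {}"
  shows "prob_space.indep_vars (PiM J P) P (\<lambda>j \<omega>. \<omega> j) J"
proof -
  interpret prob_space "PiM J P" using assms(1) by (rule prob_space_PiM)
  have "distr (PiM J P) (PiM J P) (\<lambda>x. \<lambda>i\<in>J. x i) = distr (PiM J P) (PiM J P) (\<lambda>x. x)"
    by (intro distr_cong) (auto simp: space_PiM)
  also have "\<dots> = PiM J (\<lambda>i. distr (PiM J P) (P i) (\<lambda>x. x i))"
    by (subst PiM_cong[OF refl distr_PiM_component]) (use assms in auto)
  finally show ?thesis
    using \<open>J \<noteq> {}\<close> by (subst indep_vars_iff_distr_eq_PiM') auto
qed

text \<open>Both sides have as characteristic function the same power of that of \<open>\<nu>\<close>.\<close>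

lemma (in prob_space) distr_sum_iid_shift:
  fixes X :: "nat \<Rightarrow> 'a \<Rightarrow> real"
  assumes indep: "indep_vars (\<lambda>_. borel) X {1..}"
    and iid: "\<And>k. k \<ge> 1 \<Longrightarrow> distr M borel (X k) = \<nu>"
  shows "distr M borel (\<lambda>\<omega>. \<Sum>k\<in>{a<..b}. X k \<omega>) = distr M borel (\<lambda>\<omega>. \<Sum>k\<in>{1..b-a}. X k \<omega>)"
proof (rule Levy_uniqueness)
  have [measurable]: "X k \<in> borel_measurable M" if "k \<ge> 1" for k
    using indep that by (auto simp: indep_vars_def)
  have "real_distribution (distr M borel (\<lambda>\<omega>. \<Sum>k\<in>A. X k \<omega>))" if "A \<subseteq> {1..}" for A
    using that by (intro real_distribution_distr borel_measurable_sum) auto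
  then show "real_distribution (distr M borel (\<lambda>\<omega>. \<Sum>k\<in>{a<..b}. X k \<omega>))"
    "real_distribution (distr M borel (\<lambda>\<omega>. \<Sum>k\<in>{1..b-a}. X k \<omega>))"
    by auto
  have "char (distr M borel (\<lambda>\<omega>. \<Sum>k\<in>A. X k \<omega>)) t = char \<nu> t ^ card A" if "A \<subseteq> {1..}" for A t
  proof -
    have "char (distr M borel (\<lambda>\<omega>. \<Sum>k\<in>A. X k \<omega>)) t = (\<Prod>k\<in>A. char (distr M borel (X k)) t)"
      using indep_vars_subset[OF indep that] by (rule char_distr_sum)
    also have "\<dots> = (\<Prod>k\<in>A. char \<nu> t)"
      using that iid by (intro prod.cong) auto
    finally show ?thesis by simp
  qed
  then have "char (distr M borel (\<lambda>\<omega>. \<Sum>k\<in>{a<..b}. X k \<omega>)) t = char \<nu> t ^ (b - a)"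
    and "char (distr M borel (\<lambda>\<omega>. \<Sum>k\<in>{1..b-a}. X k \<omega>)) t = char \<nu> t ^ (b - a)" for t
    by (metis card_greaterThanAtMost atLeast_iff greaterThanAtMost_iff le_less_trans less_one not_le subsetI zero_le,
        metis card_atLeastAtMost add_diff_cancel_right' Suc_eq_plus1 atLeast_iff atLeastAtMost_iff subsetI)
  then
  show "char (distr M borel (\<lambda>\<omega>. \<Sum>k\<in>{a<..b}. X k \<omega>)) = char (distr M borel (\<lambda>\<omega>. \<Sum>k\<in>{1..b-a}. X k \<omega>))"
    by (intro ext) simp
qed

section \<open>Finite-dimensional convergence of partial sums to Brownian motion\<close>

text \<open>Turns the time points, given in no particular order and possibly repeated, into a grid starting
  at 0. The grid is infinite and strictly increasing because increments of Brownian motion are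
  independent along infinite monotone sequences and have a normal density only over intervals of
  positive length.\<close>

lemma ex_strict_mono_enumeration:
  fixes A :: "real set"
  assumes "finite A" "\<And>x. x \<in> A \<Longrightarrow> 0 \<le> x"
  shows "\<exists>(s :: nat \<Rightarrow> real) d. strict_mono s \<and> s 0 = 0 \<and> 0 < d \<and> A \<subseteq> s ` {..d}"
proof -
  define l where "l = sorted_list_of_set (insert 0 A)"
  define n where "n = length l"
  have l: "set l = insert 0 A" "sorted l" "sorted_wrt (<) l"
    unfolding l_def using assms(1)
    by (simp_all only: set_sorted_list_of_set finite_insert sorted_sorted_list_of_set strict_sorted_list_of_set)
  note strict = l(3)
  have "n > 0" using l(1) by (auto simp: n_def)
  define s where "s j = (if j < n then l ! j else l ! (n - 1) + real (j - (n - 1)))" for j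
  have "strict_mono s"
    unfolding strict_mono_Suc_iff
  proof
    fix j
    consider "Suc j < n" | "Suc j = n" | "Suc j > n" by linarith
    then show "s j < s (Suc j)"
    proof cases
      case 1
      then have "l ! j < l ! Suc j" using strict unfolding n_def by (intro sorted_wrt_nth_less[of "(<)"]) auto
      then show ?thesis using 1 by (simp add: s_def)
    next
      case 2 then show ?thesis by (auto simp: s_def)
    next
      case 3 then show ?thesis using \<open>n > 0\<close> by (auto simp: s_def)
    qed
  qed
  moreover have "s 0 = 0"
  proof -
    obtain j where j: "j < n" "l ! j = 0"
      using l(1) by (metis in_set_conv_nth insertI1 n_def)
    have "l ! 0 \<le> l ! j" using j(1) l(2) by (intro sorted_nth_mono) (auto simp: n_def)
    moreover have "l ! 0 \<in> insert 0 A" using l(1) \<open>n > 0\<close> by (metis n_def nth_mem)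
    ultimately show ?thesis using j assms(2) \<open>n > 0\<close> by (fastforce simp: s_def)
  qed
  moreover have "A \<subseteq> s ` {..n}"
  proof
    fix x assume "x \<in> A"
    then obtain j where "j < n" "l ! j = x"
      using l(1) by (metis in_set_conv_nth insertI2 n_def)
    then show "x \<in> s ` {..n}" by (intro image_eqI[of _ _ j]) (auto simp: s_def)
  qed
  ultimately show ?thesis using \<open>n > 0\<close> by blast
qed

lemma tendsto_nat_floor_mult_div:
  fixes a :: real
  assumes "0 \<le> a"
  shows "((\<lambda>t. real (nat \<lfloor>t * a\<rfloor>) / t) \<longlongrightarrow> a) at_top"
proof (rule Lim_null[THEN iffD2])
  have "((\<lambda>t::real. 1 / t) \<longlongrightarrow> 0) at_top"
    by (intro tendsto_divide_0[OF tendsto_const] filterlim_at_top_imp_at_infinity filterlim_ident)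
  then show "((\<lambda>t. real (nat \<lfloor>t * a\<rfloor>) / t - a) \<longlongrightarrow> 0) at_top"
  proof (rule Lim_null_comparison[rotated])
    show "eventually (\<lambda>t. norm (real (nat \<lfloor>t * a\<rfloor>) / t - a) \<le> 1 / t) at_top"
      using eventually_gt_at_top[of 0]
    proof eventually_elim
      case (elim t)
      have "\<bar>real (nat \<lfloor>t * a\<rfloor>) - t * a\<bar> \<le> 1"
        using elim assms by (simp add: of_nat_nat) linarith
      moreover have "real (nat \<lfloor>t * a\<rfloor>) / t - a = (real (nat \<lfloor>t * a\<rfloor>) - t * a) / t"
        using elim by (simp add: field_simps)
      ultimately show ?case using elim by (simp add: abs_div_pos[symmetric] divide_right_mono)
    qed
  qed
qed

lemma distr_std_normal_increment:
  assumes BM: "standard_brownian_motion N W" and "0 \<le> s" "s < u"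
  shows "distr N borel (\<lambda>\<omega>. (W u \<omega> - W s \<omega>) / sqrt (u - s)) = std_normal_distribution"
proof -
  interpret prob_space N using BM by (simp add: standard_brownian_motion_def)
  have "distributed N lborel (\<lambda>\<omega>. W u \<omega> - W s \<omega>) (normal_density 0 (sqrt (u - s)))"
    using BM assms by (simp add: standard_brownian_motion_def)
  then have "distributed N lborel (\<lambda>\<omega>. (W u \<omega> - W s \<omega> - 0) / sqrt (u - s)) std_normal_density"
    using assms by (subst (asm) normal_standard_normal_convert) auto
  then have "distr N lborel (\<lambda>\<omega>. (W u \<omega> - W s \<omega>) / sqrt (u - s)) = std_normal_distribution"
    by (simp add: distributed_distr_eq_density)
  moreover have "distr N lborel f = distr N borel f" for f :: "'a \<Rightarrow> real"
    by (intro distr_cong) auto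
  ultimately show ?thesis by simp
qed

lemma (in prob_space) indep_vars_block_sums:
  fixes X :: "nat \<Rightarrow> 'a \<Rightarrow> real"
  assumes indep: "indep_vars (\<lambda>_. borel) X I"
    and K: "\<And>j. j \<in> J \<Longrightarrow> K j \<subseteq> I" and disj: "disjoint_family_on K J"
  shows "indep_vars (\<lambda>_. borel) (\<lambda>j \<omega>. (\<Sum>k\<in>K j. X k \<omega>) / c) J"
proof -
  have "indep_vars (\<lambda>_. borel) (\<lambda>j \<omega>. (\<Sum>k\<in>K j. restrict (\<lambda>i. X i \<omega>) (K j) k) / c) J"
    by (rule indep_vars_compose2[OF indep_vars_restrict[OF indep K disj], where Y="\<lambda>j x. (\<Sum>k\<in>K j. x k) / c"])
       auto
  then show ?thesis
    by (rule indep_vars_cong[THEN iffD1, rotated -1]) (auto intro!: ext sum.cong)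
qed

text \<open>The central limit theorem in the form given by Skorohod's representation: on one probability space
  there are copies of the normalised partial sums, for each \<open>n\<close> separately,
  that converge at every point. A number of summands that varies with a real parameter is then
  handled by composing pointwise limits.\<close>

lemma (in prob_space) central_limit_theorem_coupled:
  fixes X :: "nat \<Rightarrow> 'a \<Rightarrow> real"
  assumes indep: "indep_vars (\<lambda>_. borel) X {1..}"
    and iid: "\<And>k. k \<ge> 1 \<Longrightarrow> distr M borel (X k) = \<nu>"
    and mean: "\<And>k. k \<ge> 1 \<Longrightarrow> expectation (X k) = 0"
    and sq: "\<And>k. k \<ge> 1 \<Longrightarrow> integrable M (\<lambda>\<omega>. (X k \<omega>)\<^sup>2)"
    and var: "\<And>k. k \<ge> 1 \<Longrightarrow> expectation (\<lambda>\<omega>. (X k \<omega>)\<^sup>2) = \<sigma>\<^sup>2"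
    and "\<sigma> > 0"
  shows "\<exists>(\<Omega> :: real measure) Y Z. prob_space \<Omega> \<and> (\<forall>n. Y n \<in> borel_measurable \<Omega>) \<and>
    Z \<in> borel_measurable \<Omega> \<and>
    (\<forall>n. distr \<Omega> borel (\<lambda>x. \<sigma> * sqrt (real n) * Y n x) = distr M borel (\<lambda>\<omega>. \<Sum>k\<in>{1..n}. X k \<omega>)) \<and>
    distr \<Omega> borel Z = std_normal_distribution \<and>
    (\<forall>x\<in>space \<Omega>. (\<lambda>n. Y n x) \<longlonglongrightarrow> Z x)"
proof -
  have [measurable]: "X k \<in> borel_measurable M" if "k \<ge> 1" for k
    using indep that by (auto simp: indep_vars_def)
  define S where "S n \<omega> = (\<Sum>i<n. X (Suc i) \<omega>) / sqrt (real n * \<sigma>\<^sup>2)" for n \<omega>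
  have Sm [measurable]: "S n \<in> borel_measurable M" for n
    unfolding S_def by measurable
  have ind: "indep_vars (\<lambda>_. borel) (\<lambda>j \<omega>. X (Suc j) \<omega>) UNIV"
    using indep_vars_block_sums[OF indep, of UNIV "\<lambda>j. {Suc j}" 1] by (auto simp: disjoint_family_on_def)
  have "weak_conv_m (\<lambda>n. distr M borel (\<lambda>x. (\<Sum>i<n. X (Suc i) x - 0) / sqrt (n*\<sigma>\<^sup>2))) std_normal_distribution"
    by (rule central_limit_theorem[OF ind _ \<open>\<sigma> > 0\<close>]) (use mean sq var iid in auto)
  then have wc: "weak_conv_m (\<lambda>n. distr M borel (S n)) std_normal_distribution"
    by (simp add: S_def[abs_def])
  have "\<exists> (\<Omega> :: real measure) (Y_seq :: nat \<Rightarrow> real \<Rightarrow> real) (Y :: real \<Rightarrow> real).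
    prob_space \<Omega> \<and>
    (\<forall>n. Y_seq n \<in> measurable \<Omega> borel) \<and>
    (\<forall>n. distr \<Omega> borel (Y_seq n) = distr M borel (S n)) \<and>
    Y \<in> measurable \<Omega> lborel \<and>
    distr \<Omega> borel Y = std_normal_distribution \<and>
    (\<forall>x \<in> space \<Omega>. (\<lambda>n. Y_seq n x) \<longlonglongrightarrow> Y x)"
    by (rule Skorohod[OF _ _ wc]) (auto intro: real_distribution_distr real_dist_normal_dist)
  then obtain \<Omega> :: "real measure" and Y Z where *: "prob_space \<Omega>" "\<And>n. Y n \<in> borel_measurable \<Omega>"
    "\<And>n. distr \<Omega> borel (Y n) = distr M borel (S n)"
    "Z \<in> borel_measurable \<Omega>" "distr \<Omega> borel Z = std_normal_distribution"
    "\<forall>x\<in>space \<Omega>. (\<lambda>n. Y n x) \<longlonglongrightarrow> Z x"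
    by auto
  note *(2)[measurable]
  have "distr \<Omega> borel (\<lambda>x. \<sigma> * sqrt (real n) * Y n x) = distr M borel (\<lambda>\<omega>. \<Sum>k\<in>{1..n}. X k \<omega>)" for n
  proof -
    have "distr \<Omega> borel (\<lambda>x. \<sigma> * sqrt (real n) * Y n x)
      = distr (distr \<Omega> borel (Y n)) borel (\<lambda>y. \<sigma> * sqrt (real n) * y)"
      by (subst distr_distr) (auto simp: comp_def)
    also have "\<dots> = distr M borel (\<lambda>\<omega>. \<sigma> * sqrt (real n) * S n \<omega>)"
      unfolding *(3) by (subst distr_distr) (auto simp: comp_def)
    also have "(\<lambda>\<omega>. \<sigma> * sqrt (real n) * S n \<omega>) = (\<lambda>\<omega>. \<Sum>k\<in>{1..n}. X k \<omega>)"
    proof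
      fix \<omega>
      have "(\<Sum>i<n. X (Suc i) \<omega>) = (\<Sum>k\<in>{1..n}. X k \<omega>)"
        by (simp add: sum.atLeast1_atMost_eq)
      then show "\<sigma> * sqrt (real n) * S n \<omega> = (\<Sum>k\<in>{1..n}. X k \<omega>)"
        using \<open>\<sigma> > 0\<close> by (cases "n = 0") (auto simp: S_def real_sqrt_mult)
    qed
    finally show ?thesis .
  qed
  then show ?thesis using * by blast
qed

text \<open>Along a grid containing all the times, the partial sums and the Brownian motion both have
  independent increments, so their joint laws are determined by the laws of single increments. Each
  block of summands is replaced by its pointwise convergent copy from
  \<open>central_limit_theorem_coupled\<close>, one independent copy per block living on its own coordinate of a
  product space. There all increments converge pointwise together, and dominated convergence gives
  the limit of the expectations of any bounded continuous function.\<close>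

theorem iid_sums_fdd_converge:
  fixes X :: "nat \<Rightarrow> 'a \<Rightarrow> real" and N :: "'b measure" and u :: "real ^ 'n"
  assumes "prob_space M"
    and indep: "prob_space.indep_vars M (\<lambda>_. borel) X {1..}"
    and iid: "\<And>k. k \<ge> 1 \<Longrightarrow> distr M borel (X k) = \<nu>"
    and mean: "\<And>k. k \<ge> 1 \<Longrightarrow> prob_space.expectation M (X k) = 0"
    and sq: "\<And>k. k \<ge> 1 \<Longrightarrow> integrable M (\<lambda>\<omega>. (X k \<omega>)\<^sup>2)"
    and var: "\<And>k. k \<ge> 1 \<Longrightarrow> prob_space.expectation M (\<lambda>\<omega>. (X k \<omega>)\<^sup>2) = \<sigma>\<^sup>2"
    and "\<sigma> > 0"
    and BM: "standard_brownian_motion N W"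
    and u: "\<And>i. 0 \<le> u $ i"
  shows "weakly_converges
     (\<lambda>t::real. fdd M (\<lambda>v \<omega>. (\<Sum>k\<in>{1..nat \<lfloor>t * v\<rfloor>}. X k \<omega>) / sqrt t) u)
     (fdd N (\<lambda>v \<omega>. \<sigma> * W v \<omega>) u) at_top"
proof -
  interpret M: prob_space M by fact
  interpret N: prob_space N using BM by (simp add: standard_brownian_motion_def)
  have Xm [measurable]: "X k \<in> borel_measurable M" if "k \<ge> 1" for k
    using indep that by (auto simp: M.indep_vars_def)
  have Wm [measurable]: "W v \<in> borel_measurable N" if "v \<ge> 0" for v
    using BM that by (auto simp: standard_brownian_motion_def)
  obtain \<Omega> :: "real measure" and Y Z where \<Omega>: "prob_space \<Omega>"
    and Ym [measurable]: "\<And>n. Y n \<in> borel_measurable \<Omega>" and Zm [measurable]: "Z \<in> borel_measurable \<Omega>"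
    and Y_distr: "\<And>n. distr \<Omega> borel (\<lambda>x. \<sigma> * sqrt (real n) * Y n x) = distr M borel (\<lambda>\<omega>. \<Sum>k\<in>{1..n}. X k \<omega>)"
    and Z_distr: "distr \<Omega> borel Z = std_normal_distribution"
    and YZ: "\<And>x. x \<in> space \<Omega> \<Longrightarrow> (\<lambda>n. Y n x) \<longlonglongrightarrow> Z x"
    using M.central_limit_theorem_coupled[OF indep iid mean sq var \<open>\<sigma> > 0\<close>] by blast
  interpret \<Omega>: prob_space \<Omega> by (rule \<Omega>)
  obtain s :: "nat \<Rightarrow> real" and d where s: "strict_mono s" "s 0 = 0" "0 < d"
    and us: "range (\<lambda>i. u $ i) \<subseteq> s ` {..d}"
  proof -
    have "\<exists>(s :: nat \<Rightarrow> real) d. strict_mono s \<and> s 0 = 0 \<and> 0 < d \<and> range (\<lambda>i. u $ i) \<subseteq> s ` {..d}"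
      by (rule ex_strict_mono_enumeration) (use u in auto)
    then show ?thesis using that by blast
  qed
  have "\<forall>i. \<exists>j. j \<le> d \<and> u $ i = s j" using us by (auto simp: image_def subset_iff)
  then obtain c where c: "\<And>i. c i \<le> d" "\<And>i. u $ i = s (c i)" by metis
  have s_pos: "0 \<le> s j" for j
    using s strict_mono_less_eq[of s 0 j] by simp
  define \<Delta> where "\<Delta> j = s (Suc j) - s j" for j
  have \<Delta>: "\<Delta> j > 0" for j using s(1) by (simp add: \<Delta>_def strict_mono_Suc_iff)
  define m where "m j t = nat \<lfloor>t * s j\<rfloor>" for j and t :: real
  define n where "n j t = m (Suc j) t - m j t" for j t
  have m_mono: "m j t \<le> m j' t" if "j \<le> j'" "0 \<le> t" for j j' t
    using that s(1) by (auto simp: m_def strict_mono_less_eq intro!: nat_mono floor_mono mult_left_mono)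
  define J where "J = {..<d}"
  have J: "J \<noteq> {}" using s(3) by (auto simp: J_def)
  define P where "P = PiM J (\<lambda>_. borel :: real measure)"
  define Q where "Q = PiM J (\<lambda>_. \<Omega>)"
  interpret Q: prob_space Q unfolding Q_def by (intro prob_space_PiM \<Omega>)
  \<comment> \<open>Recovers the values at the times \<open>u\<close> from the increments along the grid.\<close>
  define G :: "(nat \<Rightarrow> real) \<Rightarrow> real ^ 'n" where "G x = (\<chi> i. \<Sum>j<c i. x j)" for x
  have Gm [measurable]: "G \<in> borel_measurable P"
    unfolding G_def P_def J_def using c(1) 
    by (intro borel_measurable_vec_lambda borel_measurable_sum measurable_component_singleton) (auto intro: less_le_trans)
  \<comment> \<open>\<open>D\<close> and \<open>E\<close> are the increments of the rescaled sums and of \<open>\<sigma> * W\<close>; \<open>z\<close> and \<open>z'\<close> are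
    their copies on the product space.\<close>
  define D where "D j t \<omega> = (\<Sum>k\<in>{m j t<..m (Suc j) t}. X k \<omega>) / sqrt t" for j t \<omega>
  define z where "z j t x = (\<sigma> * sqrt (real (n j t)) / sqrt t) * Y (n j t) (x j)" for j t and x :: "nat \<Rightarrow> real"
  define z' where "z' j x = (\<sigma> * sqrt (\<Delta> j)) * Z (x j)" for j and x :: "nat \<Rightarrow> real"
  define E where "E j \<omega> = \<sigma> * (W (s (Suc j)) \<omega> - W (s j) \<omega>)" for j \<omega>
  have Dm [measurable]: "D j t \<in> borel_measurable M" for j t
    unfolding D_def by (intro borel_measurable_divide borel_measurable_sum Xm) auto
  have Em [measurable]: "E j \<in> borel_measurable N" for j
    unfolding E_def using s_pos by (auto intro!: borel_measurable_times borel_measurable_diff Wm)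
  have comp [measurable]: "(\<lambda>x. x j) \<in> measurable Q \<Omega>" if "j \<in> J" for j
    unfolding Q_def using that by (rule measurable_component_singleton)
  have zm [measurable]: "z j t \<in> borel_measurable Q" if "j \<in> J" for j t
    unfolding z_def using that by measurable
  have z'm [measurable]: "z' j \<in> borel_measurable Q" if "j \<in> J" for j
    unfolding z'_def using that by measurable
  have coord: "distr Q borel (\<lambda>x. f (x j)) = distr \<Omega> borel f" if "j \<in> J" "f \<in> borel_measurable \<Omega>" for f j
  proof -
    have "distr \<Omega> borel f = distr (distr Q \<Omega> (\<lambda>x. x j)) borel f"
      unfolding Q_def using \<Omega> that by (subst distr_PiM_component) auto
    also have "\<dots> = distr Q borel (\<lambda>x. f (x j))"
      using that by (subst distr_distr) (auto simp: comp_def)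
    finally show ?thesis by simp
  qed
  have indQ: "Q.indep_vars (\<lambda>_. borel) (\<lambda>j x. f j (x j)) J" if "\<And>j. f j \<in> borel_measurable \<Omega>" for f :: "nat \<Rightarrow> real \<Rightarrow> real"
  proof (rule Q.indep_vars_compose2[where Y=f and X="\<lambda>j x. x j"])
    show "Q.indep_vars (\<lambda>_. \<Omega>) (\<lambda>j x. x j) J"
      unfolding Q_def by (rule indep_vars_PiM_coordinates[OF \<Omega> J])
  qed (use that in auto)

  have lawM: "distr M P (\<lambda>\<omega>. \<lambda>j\<in>J. D j t \<omega>) = distr Q P (\<lambda>x. \<lambda>j\<in>J. z j t x)" if "t \<ge> 0" for t
    unfolding P_def
  proof (rule distr_indep_vars_cong[OF \<open>prob_space M\<close> Q.prob_space_axioms J])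
    show "M.indep_vars (\<lambda>_. borel) (\<lambda>j. D j t) J"
      unfolding D_def
    proof (rule M.indep_vars_block_sums[OF indep])
      show "disjoint_family_on (\<lambda>j. {m j t<..m (Suc j) t}) J"
        unfolding disjoint_family_on_def
      proof (intro ballI impI)
        fix i j assume "i \<in> J" "j \<in> J" "i \<noteq> j"
        then consider "Suc i \<le> j" | "Suc j \<le> i" by linarith
        then show "{m i t<..m (Suc i) t} \<inter> {m j t<..m (Suc j) t} = {}"
          using m_mono[of "Suc i" j t] m_mono[of "Suc j" i t] that by cases auto
      qed
    qed auto
    show "Q.indep_vars (\<lambda>_. borel) (\<lambda>j. z j t) J"
      unfolding z_def by (rule indQ) measurable
    fix j assume j: "j \<in> J"
    have "distr M borel (D j t) = distr (distr M borel (\<lambda>\<omega>. \<Sum>k\<in>{m j t<..m (Suc j) t}. X k \<omega>)) borel (\<lambda>y. y / sqrt t)"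
      unfolding D_def by (subst distr_distr) (auto simp: comp_def intro!: borel_measurable_sum Xm)
    also have "\<dots> = distr (distr M borel (\<lambda>\<omega>. \<Sum>k\<in>{1..n j t}. X k \<omega>)) borel (\<lambda>y. y / sqrt t)"
      using M.distr_sum_iid_shift[OF indep iid] by (simp add: n_def)
    also have "\<dots> = distr \<Omega> borel (\<lambda>x. (\<sigma> * sqrt (real (n j t)) / sqrt t) * Y (n j t) x)"
      unfolding Y_distr[symmetric] by (subst distr_distr) (auto simp: comp_def)
    also have "\<dots> = distr Q borel (z j t)"
      unfolding z_def by (rule coord[symmetric, OF j]) measurable
    finally show "distr M borel (D j t) = distr Q borel (z j t)" .
  qed
  have lawN: "distr N P (\<lambda>\<omega>. \<lambda>j\<in>J. E j \<omega>) = distr Q P (\<lambda>x. \<lambda>j\<in>J. z' j x)"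
    unfolding P_def
  proof (rule distr_indep_vars_cong[OF N.prob_space_axioms Q.prob_space_axioms J])
    have "N.indep_vars (\<lambda>_. borel) (\<lambda>i \<omega>. W (s (Suc i)) \<omega> - W (s i) \<omega>) J"
      using BM s strict_mono_mono[OF s(1)] by (auto simp: standard_brownian_motion_def J_def)
    then show "N.indep_vars (\<lambda>_. borel) E J"
      unfolding E_def by (rule N.indep_vars_compose2[where Y="\<lambda>_ x. \<sigma> * x"]) auto
    show "Q.indep_vars (\<lambda>_. borel) z' J"
      unfolding z'_def by (rule indQ) measurable
    fix j assume j: "j \<in> J"
    have "distr N borel (E j) = distr (distr N borel (\<lambda>\<omega>. (W (s (Suc j)) \<omega> - W (s j) \<omega>) / sqrt (\<Delta> j))) borel
        (\<lambda>y. (\<sigma> * sqrt (\<Delta> j)) * y)"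
      unfolding E_def using \<Delta>[of j] s_pos
      by (subst distr_distr) (auto simp: comp_def intro!: borel_measurable_divide borel_measurable_diff Wm)
    also have "\<dots> = distr (distr \<Omega> borel Z) borel (\<lambda>y. (\<sigma> * sqrt (\<Delta> j)) * y)"
      unfolding Z_distr \<Delta>_def using \<Delta>[of j] by (subst distr_std_normal_increment[OF BM s_pos]) (auto simp: \<Delta>_def)
    also have "\<dots> = distr \<Omega> borel (\<lambda>x. (\<sigma> * sqrt (\<Delta> j)) * Z x)"
      by (subst distr_distr) (auto simp: comp_def)
    also have "\<dots> = distr Q borel (z' j)"
      unfolding z'_def by (rule coord[symmetric, OF j]) measurable
    finally show "distr N borel (E j) = distr Q borel (z' j)" .
  qed

  have conv_z: "((\<lambda>t. z j t x) \<longlongrightarrow> z' j x) at_top" if j: "j \<in> J" and x: "x \<in> space Q" for j x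
  proof -
    have xj: "x j \<in> space \<Omega>" using j x by (auto simp: Q_def space_PiM)
    have nt: "((\<lambda>t. real (n j t) / t) \<longlongrightarrow> \<Delta> j) at_top"
    proof (rule Lim_transform_eventually)
      show "((\<lambda>t. real (m (Suc j) t) / t - real (m j t) / t) \<longlongrightarrow> \<Delta> j) at_top"
        unfolding m_def \<Delta>_def by (intro tendsto_diff tendsto_nat_floor_mult_div s_pos)
      show "eventually (\<lambda>t. real (m (Suc j) t) / t - real (m j t) / t = real (n j t) / t) at_top"
        using eventually_ge_at_top[of 0]
        by eventually_elim (use m_mono[of j "Suc j"] in \<open>auto simp: n_def of_nat_diff diff_divide_distrib\<close>)
    qed
    have "filterlim (\<lambda>t. real (n j t) / t * t) at_top at_top"
      by (rule filterlim_tendsto_pos_mult_at_top[OF nt \<Delta> filterlim_ident])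
    then have "filterlim (\<lambda>t. real (n j t)) at_top at_top"
      by (rule filterlim_mono_eventually[OF _ order_refl order_refl])
         (use eventually_gt_at_top[of 0] in eventually_elim, auto)
    then have "filterlim (n j) sequentially at_top"
      by (simp add: filterlim_sequentially_iff_filterlim_real)
    then have limY: "((\<lambda>t. Y (n j t) (x j)) \<longlongrightarrow> Z (x j)) at_top"
      by (rule filterlim_compose[OF YZ[OF xj]])
    have "((\<lambda>t. \<sigma> * sqrt (real (n j t) / t)) \<longlongrightarrow> \<sigma> * sqrt (\<Delta> j)) at_top"
      by (intro tendsto_intros nt)
    from tendsto_mult[OF this limY] show ?thesis
      unfolding z_def z'_def by (simp add: real_sqrt_divide)
  qed

  have sumD: "G (\<lambda>j\<in>J. D j t \<omega>) = (\<chi> i. (\<Sum>k\<in>{1..nat \<lfloor>t * (u $ i)\<rfloor>}. X k \<omega>) / sqrt t)" if "t \<ge> 0" for t \<omega>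
  proof -
    have "(\<Sum>j<q. \<Sum>k\<in>{m j t<..m (Suc j) t}. X k \<omega>) = (\<Sum>k\<in>{1..m q t}. X k \<omega>)" for q
    proof (induction q)
      case 0 then show ?case using s(2) by (simp add: m_def)
    next
      case (Suc q)
      have "{1..m (Suc q) t} = {1..m q t} \<union> {m q t<..m (Suc q) t}"
        using m_mono[of q "Suc q" t] that by auto
      then show ?case using Suc by (subst (asm) Suc, simp) (subst sum.union_disjoint, auto)
    qed
    moreover have "(\<Sum>j<c i. (\<lambda>j\<in>J. D j t \<omega>) j) = (\<Sum>j<c i. \<Sum>k\<in>{m j t<..m (Suc j) t}. X k \<omega>) / sqrt t" for i
      unfolding sum_divide_distrib
      by (intro sum.cong) (use c(1)[of i] in \<open>auto simp: J_def D_def sum_divide_distrib\<close>)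
    ultimately show ?thesis
      unfolding G_def by (simp add: m_def c(2))
  qed
  have sumE: "AE \<omega> in N. G (\<lambda>j\<in>J. E j \<omega>) = (\<chi> i. \<sigma> * W (u $ i) \<omega>)"
  proof -
    have "AE \<omega> in N. W 0 \<omega> = 0" using BM by (simp add: standard_brownian_motion_def)
    then show ?thesis
    proof eventually_elim
      case (elim \<omega>)
      have "(\<Sum>j<c i. (\<lambda>j\<in>J. E j \<omega>) j) = (\<Sum>j<c i. \<sigma> * W (s (Suc j)) \<omega> - \<sigma> * W (s j) \<omega>)" for i
        by (intro sum.cong) (use c(1)[of i] in \<open>auto simp: J_def E_def algebra_simps\<close>)
      also have "\<dots> i = \<sigma> * W (s (c i)) \<omega>" for i
        using elim s(2) by (subst sum_lessThan_telescope) simp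
      finally show ?case unfolding G_def by (simp add: c(2))
    qed
  qed

  show ?thesis
    unfolding weakly_converges_def fdd_def
  proof (intro allI impI)
    fix f :: "real ^ 'n \<Rightarrow> real" assume f: "continuous_on UNIV f \<and> bounded (range f)"
    then have contf: "continuous_on UNIV f" by simp
    have fm [measurable]: "f \<in> borel_measurable borel"
      using contf by (rule borel_measurable_continuous_onI)
    from f obtain B where B: "\<And>x. \<bar>f x\<bar> \<le> B"
      unfolding bounded_iff by auto
    have Dr [measurable]: "(\<lambda>\<omega>. \<lambda>j\<in>J. D j t \<omega>) \<in> measurable M P" for t
      unfolding P_def by measurable
    have Er [measurable]: "(\<lambda>\<omega>. \<lambda>j\<in>J. E j \<omega>) \<in> measurable N P"
      unfolding P_def by measurable
    have zr [measurable]: "(\<lambda>x. \<lambda>j\<in>J. z j t x) \<in> measurable Q P" for t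
      unfolding P_def by measurable
    have z'r [measurable]: "(\<lambda>x. \<lambda>j\<in>J. z' j x) \<in> measurable Q P"
      unfolding P_def by measurable
    have lhs: "integral\<^sup>L (distr M borel (\<lambda>\<omega>. \<chi> i. (\<Sum>k\<in>{1..nat \<lfloor>t * (u $ i)\<rfloor>}. X k \<omega>) / sqrt t)) f
      = (\<integral>x. f (G (\<lambda>j\<in>J. z j t x)) \<partial>Q)" if "t \<ge> 0" for t
    proof -
      have "integral\<^sup>L (distr M borel (\<lambda>\<omega>. \<chi> i. (\<Sum>k\<in>{1..nat \<lfloor>t * (u $ i)\<rfloor>}. X k \<omega>) / sqrt t)) f
        = (\<integral>\<omega>. f (G (\<lambda>j\<in>J. D j t \<omega>)) \<partial>M)"
        unfolding sumD[OF that, symmetric] by (rule integral_distr) measurable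
      also have "\<dots> = (\<integral>y. f (G y) \<partial>distr M P (\<lambda>\<omega>. \<lambda>j\<in>J. D j t \<omega>))"
        by (rule integral_distr[symmetric]) measurable
      also have "\<dots> = (\<integral>x. f (G (\<lambda>j\<in>J. z j t x)) \<partial>Q)"
        unfolding lawM[OF that] by (rule integral_distr) measurable
      finally show ?thesis .
    qed
    have Wu [measurable]: "(\<lambda>\<omega>. \<chi> i. \<sigma> * W (u $ i) \<omega>) \<in> borel_measurable N"
      using u by (intro borel_measurable_vec_lambda borel_measurable_times Wm) auto
    have rhs: "integral\<^sup>L (distr N borel (\<lambda>\<omega>. \<chi> i. \<sigma> * W (u $ i) \<omega>)) f = (\<integral>x. f (G (\<lambda>j\<in>J. z' j x)) \<partial>Q)"
    proof -
      have "integral\<^sup>L (distr N borel (\<lambda>\<omega>. \<chi> i. \<sigma> * W (u $ i) \<omega>)) f = (\<integral>\<omega>. f (\<chi> i. \<sigma> * W (u $ i) \<omega>) \<partial>N)"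
        by (rule integral_distr) measurable
      also have "\<dots> = (\<integral>\<omega>. f (G (\<lambda>j\<in>J. E j \<omega>)) \<partial>N)"
      proof (rule integral_cong_AE)
        show "AE \<omega> in N. f (\<chi> i. \<sigma> * W (u $ i) \<omega>) = f (G (\<lambda>j\<in>J. E j \<omega>))"
          using sumE by eventually_elim simp
      qed measurable
      also have "\<dots> = (\<integral>y. f (G y) \<partial>distr N P (\<lambda>\<omega>. \<lambda>j\<in>J. E j \<omega>))"
        by (rule integral_distr[symmetric]) measurable
      also have "\<dots> = (\<integral>x. f (G (\<lambda>j\<in>J. z' j x)) \<partial>Q)"
        unfolding lawN by (rule integral_distr) measurable
      finally show ?thesis .
    qed
    have "((\<lambda>t. \<integral>x. f (G (\<lambda>j\<in>J. z j t x)) \<partial>Q) \<longlongrightarrow> (\<integral>x. f (G (\<lambda>j\<in>J. z' j x)) \<partial>Q)) at_top"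
    proof (rule integral_dominated_convergence_at_top[where w="\<lambda>_. B"])
      show "AE x in Q. ((\<lambda>t. f (G (\<lambda>j\<in>J. z j t x))) \<longlongrightarrow> f (G (\<lambda>j\<in>J. z' j x))) at_top"
      proof (rule AE_I2)
        fix x assume x: "x \<in> space Q"
        have "((\<lambda>t. G (\<lambda>j\<in>J. z j t x)) \<longlongrightarrow> G (\<lambda>j\<in>J. z' j x)) at_top"
          unfolding G_def
        proof (intro tendsto_vec_lambda tendsto_sum)
          fix i j assume "j \<in> {..<c i}"
          then have "j \<in> J" using c(1)[of i] by (auto simp: J_def)
          then show "((\<lambda>t. (\<lambda>j\<in>J. z j t x) j) \<longlongrightarrow> (\<lambda>j\<in>J. z' j x) j) at_top"
            using conv_z[OF _ x] by simp
        qed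
        then show "((\<lambda>t. f (G (\<lambda>j\<in>J. z j t x))) \<longlongrightarrow> f (G (\<lambda>j\<in>J. z' j x))) at_top"
          by (rule continuous_on_tendsto_compose[OF contf]) auto
      qed
    qed (use B in auto)
    then show "((\<lambda>t. integral\<^sup>L (distr M borel (\<lambda>\<omega>. \<chi> i. (\<Sum>k\<in>{1..nat \<lfloor>t * (u $ i)\<rfloor>}. X k \<omega>) / sqrt t)) f)
       \<longlongrightarrow> integral\<^sup>L (distr N borel (\<lambda>\<omega>. \<chi> i. \<sigma> * W (u $ i) \<omega>)) f) at_top"
      unfolding rhs
      by (rule Lim_transform_eventually)
         (use eventually_ge_at_top[of 0] in eventually_elim, rule lhs[symmetric])
  qed
qed

section \<open>Prime factors of the least common multiple\<close>

lemma infsum_ennreal_eq_nn_integral: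
  fixes f :: "nat \<Rightarrow> ennreal"
  shows "infsum f A = (\<integral>\<^sup>+x. f x \<partial>count_space A)"
proof -
  have "infsum f A = infsum (\<lambda>x. f x * indicator A x) UNIV"
    by (intro infsum_cong_neutral) auto
  also have "\<dots> = (\<Sum>x. f x * indicator A x)"
    by (intro sums_unique has_sum_imp_sums has_sum_infsum nonneg_summable_on_complete) simp
  also have "\<dots> = (\<integral>\<^sup>+x. f x * indicator A x \<partial>count_space UNIV)"
    by (rule nn_integral_count_space_nat[symmetric])
  also have "\<dots> = (\<integral>\<^sup>+x. f x \<partial>count_space A)"
    by (simp add: nn_integral_restrict_space[symmetric] restrict_count_space)
  finally show ?thesis .
qed

lemma ln_eq_sum_multiplicity:
  fixes n :: nat
  assumes "0 < n" "finite F" "prime_factors n \<subseteq> F" "\<And>p. p \<in> F \<Longrightarrow> prime p"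
  shows "ln (real n) = (\<Sum>p\<in>F. real (multiplicity p n) * ln (real p))"
proof -
  have pos: "0 < real p" if "p \<in> prime_factors n" for p
    using that by (auto simp: in_prime_factors_iff prime_gt_0_nat)
  have "real n = (\<Prod>p\<in>prime_factors n. real p ^ multiplicity p n)"
    using prime_factorization_nat[OF assms(1)] by (metis (no_types, lifting) of_nat_power of_nat_prod prod.cong)
  then have "ln (real n) = (\<Sum>p\<in>prime_factors n. ln (real p ^ multiplicity p n))"
    using pos by (simp add: ln_prod)
  also have "\<dots> = (\<Sum>p\<in>prime_factors n. real (multiplicity p n) * ln (real p))"
    using pos by (intro sum.cong) (auto simp: ln_realpow)
  also have "\<dots> = (\<Sum>p\<in>F. real (multiplicity p n) * ln (real p))"
    using assms by (intro sum.mono_neutral_left)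
      (auto simp: in_prime_factors_iff not_dvd_imp_multiplicity_0)
  finally show ?thesis .
qed

text \<open>The extended nonnegative integral over all primes allows the sum over primes to be interchanged with
  an expectation, although only finitely many primes contribute at each sample point.\<close>

lemma ln_diff_le_nn_integral_primes:
  fixes x y :: nat and r :: "nat \<Rightarrow> nat"
  assumes "0 < x" "0 < y"
    and mult: "\<And>p. prime p \<Longrightarrow> multiplicity p x \<le> multiplicity p y + r p"
  shows "ennreal (ln (real x) - ln (real y))
    \<le> (\<integral>\<^sup>+p. of_nat (r p) * ennreal (ln (real p)) \<partial>count_space {p. prime p})"
proof -
  define F where "F = prime_factors x \<union> prime_factors y"
  have F: "finite F" "\<And>p. p \<in> F \<Longrightarrow> prime p" by (auto simp: F_def)
  have lnp: "0 \<le> ln (real p)" if "p \<in> F" for p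
    using F(2)[OF that] prime_ge_1_nat[of p] by simp
  have "ln (real x) - ln (real y) = (\<Sum>p\<in>F. (real (multiplicity p x) - real (multiplicity p y)) * ln (real p))"
    using F assms(1,2) by (subst (1 2) ln_eq_sum_multiplicity[where F=F])
      (auto simp: F_def sum_subtractf left_diff_distrib)
  also have "\<dots> \<le> (\<Sum>p\<in>F. real (r p) * ln (real p))"
  proof (intro sum_mono mult_right_mono lnp)
    fix p assume "p \<in> F"
    then show "real (multiplicity p x) - real (multiplicity p y) \<le> real (r p)"
      using mult[OF F(2), of p] by linarith
  qed
  finally have "ennreal (ln (real x) - ln (real y)) \<le> ennreal (\<Sum>p\<in>F. real (r p) * ln (real p))"
    by (rule ennreal_leI)
  also have "\<dots> = (\<Sum>p\<in>F. of_nat (r p) * ennreal (ln (real p)))"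
    using lnp by (subst sum_ennreal[symmetric]) (auto simp: ennreal_mult ennreal_of_nat_eq_real_of_nat)
  also have "\<dots> = (\<integral>\<^sup>+p. of_nat (r p) * ennreal (ln (real p)) \<partial>count_space F)"
    using F by (simp add: nn_integral_count_space_finite)
  also have "\<dots> = (\<integral>\<^sup>+p. of_nat (r p) * ennreal (ln (real p)) * indicator F p \<partial>count_space {p. prime p})"
    using F by (subst nn_integral_restrict_space[symmetric]) (auto simp: restrict_count_space Int_absorb2 subset_iff Int_commute)
  also have "\<dots> \<le> (\<integral>\<^sup>+p. of_nat (r p) * ennreal (ln (real p)) \<partial>count_space {p. prime p})"
    by (intro nn_integral_mono) (auto simp: indicator_def)
  finally show ?thesis .
qed

lemma multiplicity_Lcm_le:
  fixes A :: "nat set"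
  assumes "finite A" "\<And>a. a \<in> A \<Longrightarrow> 0 < a" "\<And>a. a \<in> A \<Longrightarrow> multiplicity p a \<le> b" "prime p"
  shows "multiplicity p (Lcm A) \<le> b"
  using assms(1-3)
proof (induction A)
  case (insert a A)
  have "Lcm A \<noteq> 0" using insert by (auto simp: Lcm_0_iff)
  then have "multiplicity p (lcm a (Lcm A)) = max (multiplicity p a) (multiplicity p (Lcm A))"
    using insert \<open>prime p\<close> by (intro multiplicity_lcm) auto
  then show ?case using insert by auto
qed simp

text \<open>If \<open>\<Theta>\<^sub>k\<close> carries a higher power of \<open>p\<close> than \<open>\<xi>\<^sub>1 \<cdots> \<xi>\<^sub>k\<close>, the surplus is paid off by the
  factors \<open>\<xi>\<^sub>k\<^sub>+\<^sub>1, \<dots>, \<xi>\<^sub>k\<^sub>+\<^sub>m\<close>; this is what is left of it. The truncation of subtraction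
  on the naturals takes the positive part; applying it after every payment or once at the end
  makes no difference.\<close>
definition residual :: "nat \<Rightarrow> (nat \<Rightarrow> 'a \<Rightarrow> nat) \<Rightarrow> (nat \<Rightarrow> 'a \<Rightarrow> nat) \<Rightarrow> nat \<Rightarrow> nat \<Rightarrow> 'a \<Rightarrow> nat" where
  "residual p \<xi> \<eta> k m \<omega> = multiplicity p (\<eta> k \<omega>) - multiplicity p (\<xi> k \<omega>)
     - (\<Sum>i\<in>{k<..k+m}. multiplicity p (\<xi> i \<omega>))"

lemma Pi_walk_pos:
  assumes "\<And>k. k \<in> {1..n} \<Longrightarrow> 0 < \<xi> k \<omega>"
  shows "0 < Pi_walk \<xi> n \<omega>"
  using assms by (auto simp: Pi_walk_def intro!: prod_pos)

lemma multiplicity_Pi_walk: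
  assumes "\<And>k. k \<in> {1..n} \<Longrightarrow> 0 < \<xi> k \<omega>" "prime p"
  shows "multiplicity p (Pi_walk \<xi> n \<omega>) = (\<Sum>k\<in>{1..n}. multiplicity p (\<xi> k \<omega>))"
proof -
  have "0 \<notin> (\<lambda>k. \<xi> k \<omega>) ` {1..n}" using assms(1) by (metis imageE less_irrefl)
  then show ?thesis
    unfolding Pi_walk_def using assms(2) by (intro prime_elem_multiplicity_prod_distrib) auto
qed

lemma L_lcm_pos:
  assumes "\<And>k. k \<ge> 1 \<Longrightarrow> 0 < \<xi> k \<omega>" "\<And>k. k \<ge> 1 \<Longrightarrow> 0 < \<eta> k \<omega>"
  shows "0 < L_lcm \<xi> \<eta> n \<omega>"
proof -
  have "Theta \<xi> \<eta> k \<omega> \<noteq> 0" if "k \<ge> 1" for k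
    using Pi_walk_pos[of "k - 1" \<xi> \<omega>] assms that by (auto simp: Theta_def)
  then have "\<forall>k\<in>{1..n}. 0 \<noteq> Theta \<xi> \<eta> k \<omega>" by simp
  then have "0 \<notin> (\<lambda>k. Theta \<xi> \<eta> k \<omega>) ` {1..n}" by blast
  then have "L_lcm \<xi> \<eta> n \<omega> \<noteq> 0"
    unfolding L_lcm_def using Lcm_0_iff[of "(\<lambda>k. Theta \<xi> \<eta> k \<omega>) ` {1..n}"] by blast
  then show ?thesis by simp
qed

text \<open>The multiplicity in the least common multiple is the largest one among the \<open>\<Theta>\<^sub>k\<close>. That
  of \<open>\<Theta>\<^sub>k\<close> exceeds that of \<open>\<xi>\<^sub>1 \<cdots> \<xi>\<^sub>n\<close> by at most the surplus of \<open>\<eta>\<^sub>k\<close> over \<open>\<xi>\<^sub>k\<close> that the remaining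
  \<open>n - k\<close> factors have not paid off. Replacing the maximum over \<open>k\<close> by the sum is affordable for the
  expectations below.\<close>

lemma multiplicity_L_lcm_le:
  assumes \<xi>: "\<And>k. k \<ge> 1 \<Longrightarrow> 0 < \<xi> k \<omega>" and \<eta>: "\<And>k. k \<ge> 1 \<Longrightarrow> 0 < \<eta> k \<omega>" and p: "prime p"
  shows "multiplicity p (L_lcm \<xi> \<eta> n \<omega>)
    \<le> multiplicity p (Pi_walk \<xi> n \<omega>) + (\<Sum>k\<in>{1..n}. residual p \<xi> \<eta> k (n - k) \<omega>)"
  unfolding L_lcm_def
proof (rule multiplicity_Lcm_le[OF _ _ _ p])
  fix a assume "a \<in> (\<lambda>k. Theta \<xi> \<eta> k \<omega>) ` {1..n}"
  then obtain k where k: "1 \<le> k" "k \<le> n" and a: "a = Pi_walk \<xi> (k - 1) \<omega> * \<eta> k \<omega>"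
    by (auto simp: Theta_def)
  have pos: "0 < Pi_walk \<xi> (k - 1) \<omega>" using \<xi> by (intro Pi_walk_pos) auto
  then show "0 < a" using a \<eta> k by simp
  let ?l = "\<lambda>k. multiplicity p (\<xi> k \<omega>)"
  have "multiplicity p a = (\<Sum>i\<in>{1..k-1}. ?l i) + multiplicity p (\<eta> k \<omega>)"
    unfolding a using pos \<eta>[OF k(1)] p \<xi>
    by (subst prime_elem_multiplicity_mult_distrib) (auto intro!: multiplicity_Pi_walk simp flip: One_nat_def)
  moreover have "multiplicity p (Pi_walk \<xi> n \<omega>) = (\<Sum>i\<in>{1..k-1}. ?l i) + ?l k + (\<Sum>i\<in>{k<..n}. ?l i)"
  proof -
    have "{1..n} = {1..k-1} \<union> {k} \<union> {k<..n}" using k by auto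
    then have "(\<Sum>i\<in>{1..n}. ?l i) = (\<Sum>i\<in>{1..k-1} \<union> {k} \<union> {k<..n}. ?l i)" by simp
    also have "\<dots> = (\<Sum>i\<in>{1..k-1}. ?l i) + ?l k + (\<Sum>i\<in>{k<..n}. ?l i)"
      using k by (subst sum.union_disjoint, auto)+
    finally show ?thesis using \<xi> p by (subst multiplicity_Pi_walk) auto
  qed
  moreover have "residual p \<xi> \<eta> k (n - k) \<omega> \<le> (\<Sum>k\<in>{1..n}. residual p \<xi> \<eta> k (n - k) \<omega>)"
    using k by (intro member_le_sum) auto
  moreover have "residual p \<xi> \<eta> k (n - k) \<omega> = multiplicity p (\<eta> k \<omega>) - ?l k - (\<Sum>i\<in>{k<..n}. ?l i)"
    using k by (simp add: residual_def)
  ultimately show "multiplicity p a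
    \<le> multiplicity p (Pi_walk \<xi> n \<omega>) + (\<Sum>k\<in>{1..n}. residual p \<xi> \<eta> k (n - k) \<omega>)"
    by linarith
qed simp

lemma ln_Pi_walk:
  assumes "\<And>k. k \<in> {1..n} \<Longrightarrow> 0 < \<xi> k \<omega>"
  shows "ln (real (Pi_walk \<xi> n \<omega>)) = (\<Sum>k\<in>{1..n}. ln (real (\<xi> k \<omega>)))"
  unfolding Pi_walk_def of_nat_prod using assms by (intro ln_prod) auto

text \<open>The least common multiple is divisible by \<open>\<Theta>\<^sub>n\<close>, hence by \<open>\<xi>\<^sub>1 \<cdots> \<xi>\<^sub>n\<^sub>-\<^sub>1\<close>.\<close>

lemma ln_Pi_walk_le_ln_L_lcm:
  assumes \<xi>: "\<And>k. k \<ge> 1 \<Longrightarrow> 0 < \<xi> k \<omega>" and \<eta>: "\<And>k. k \<ge> 1 \<Longrightarrow> 0 < \<eta> k \<omega>" and "n \<ge> 1"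
  shows "ln (real (Pi_walk \<xi> n \<omega>)) \<le> ln (real (L_lcm \<xi> \<eta> n \<omega>)) + ln (real (\<xi> n \<omega>))"
proof -
  have "Theta \<xi> \<eta> n \<omega> dvd L_lcm \<xi> \<eta> n \<omega>"
    unfolding L_lcm_def using \<open>n \<ge> 1\<close> by (intro dvd_Lcm) auto
  then have "Pi_walk \<xi> (n - 1) \<omega> dvd L_lcm \<xi> \<eta> n \<omega>"
    unfolding Theta_def by (rule dvd_mult_left)
  then have "Pi_walk \<xi> (n - 1) \<omega> \<le> L_lcm \<xi> \<eta> n \<omega>"
    using L_lcm_pos[of \<xi> \<omega> \<eta> n] \<xi> \<eta> by (intro dvd_imp_le) auto
  moreover have "0 < Pi_walk \<xi> (n - 1) \<omega>" using \<xi> by (intro Pi_walk_pos) auto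
  ultimately have "ln (real (Pi_walk \<xi> (n - 1) \<omega>)) \<le> ln (real (L_lcm \<xi> \<eta> n \<omega>))" by simp
  moreover have "{1..n} = insert n {1..n-1}" using \<open>n \<ge> 1\<close> by auto
  then have "ln (real (Pi_walk \<xi> n \<omega>)) = ln (real (Pi_walk \<xi> (n - 1) \<omega>)) + ln (real (\<xi> n \<omega>))"
    using \<xi> \<open>n \<ge> 1\<close> by (subst (1 2) ln_Pi_walk) auto
  ultimately show ?thesis by simp
qed

section \<open>Expected surplus at a single prime\<close>

lemma (in prob_space) nn_integral_indep_var:
  assumes indep: "indep_var S X T Y" and h [measurable]: "case_prod h \<in> borel_measurable (S \<Otimes>\<^sub>M T)"
  shows "(\<integral>\<^sup>+\<omega>. h (X \<omega>) (Y \<omega>) \<partial>M) = (\<integral>\<^sup>+\<omega>. \<integral>\<^sup>+\<omega>'. h (X \<omega>) (Y \<omega>') \<partial>M \<partial>M)"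
proof -
  have [measurable]: "random_variable S X" "random_variable T Y"
    using indep by (auto dest: indep_var_rv1 indep_var_rv2)
  interpret Y: prob_space "distr M T Y" by (rule prob_space_distr) measurable
  have "(\<integral>\<^sup>+\<omega>. h (X \<omega>) (Y \<omega>) \<partial>M) = (\<integral>\<^sup>+z. case_prod h z \<partial>distr M (S \<Otimes>\<^sub>M T) (\<lambda>\<omega>. (X \<omega>, Y \<omega>)))"
    by (subst nn_integral_distr) auto
  also have "distr M (S \<Otimes>\<^sub>M T) (\<lambda>\<omega>. (X \<omega>, Y \<omega>)) = distr M S X \<Otimes>\<^sub>M distr M T Y"
    using indep by (simp add: indep_var_distribution_eq)
  also have "(\<integral>\<^sup>+z. case_prod h z \<partial>(distr M S X \<Otimes>\<^sub>M distr M T Y))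
      = (\<integral>\<^sup>+x. \<integral>\<^sup>+y. h x y \<partial>distr M T Y \<partial>distr M S X)"
    by (subst Y.nn_integral_fst[symmetric]) auto
  also have "\<dots> = (\<integral>\<^sup>+\<omega>. \<integral>\<^sup>+y. h (X \<omega>) y \<partial>distr M T Y \<partial>M)"
    by (subst nn_integral_distr) (auto intro!: Y.borel_measurable_nn_integral)
  also have "\<dots> = (\<integral>\<^sup>+\<omega>. \<integral>\<^sup>+\<omega>'. h (X \<omega>) (Y \<omega>') \<partial>M \<partial>M)"
  proof (rule nn_integral_cong)
    fix \<omega> assume "\<omega> \<in> space M"
    then have [measurable]: "X \<omega> \<in> space S" by (rule measurable_space[rotated]) measurable
    show "(\<integral>\<^sup>+y. h (X \<omega>) y \<partial>distr M T Y) = (\<integral>\<^sup>+\<omega>'. h (X \<omega>) (Y \<omega>') \<partial>M)"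
      by (subst nn_integral_distr) auto
  qed
  finally show ?thesis .
qed

lemma measurable_binop_nat:
  fixes F :: "nat \<Rightarrow> nat \<Rightarrow> nat"
  assumes "f \<in> M \<rightarrow>\<^sub>M count_space UNIV" "g \<in> M \<rightarrow>\<^sub>M count_space UNIV"
  shows "(\<lambda>x. F (f x) (g x)) \<in> M \<rightarrow>\<^sub>M count_space UNIV"
  using measurable_compose[OF measurable_Pair[OF assms], of "case_prod F" "count_space UNIV"]
  by (simp add: pair_measure_countable)

locale iid_pairs = prob_space M for M :: "'a measure" +
  fixes \<xi> \<eta> :: "'a \<Rightarrow> nat" and \<xi>s \<eta>s :: "nat \<Rightarrow> 'a \<Rightarrow> nat"
  assumes generic: "(\<lambda>\<omega>. (\<xi> \<omega>, \<eta> \<omega>)) \<in> M \<rightarrow>\<^sub>M posnat2"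
    and indep: "indep_vars (\<lambda>_. posnat2) (\<lambda>k \<omega>. (\<xi>s k \<omega>, \<eta>s k \<omega>)) {1..}"
    and copies: "\<And>k. k \<ge> 1 \<Longrightarrow>
          distr M posnat2 (\<lambda>\<omega>. (\<xi>s k \<omega>, \<eta>s k \<omega>)) = distr M posnat2 (\<lambda>\<omega>. (\<xi> \<omega>, \<eta> \<omega>))"
begin

lemma generic_pos: "\<omega> \<in> space M \<Longrightarrow> 0 < \<xi> \<omega>"
  using measurable_space[OF generic, of \<omega>] by auto

lemma copy_measurable: "k \<ge> 1 \<Longrightarrow> (\<lambda>\<omega>. (\<xi>s k \<omega>, \<eta>s k \<omega>)) \<in> M \<rightarrow>\<^sub>M posnat2"
  using indep by (auto simp: indep_vars_def)

lemma copy_pos: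
  assumes "k \<ge> 1" "\<omega> \<in> space M"
  shows "0 < \<xi>s k \<omega>" "0 < \<eta>s k \<omega>"
  using measurable_space[OF copy_measurable[OF assms(1)] assms(2)] by auto

lemma measurable_fun_generic:
  assumes "\<And>x y. f x y \<in> space T"
  shows "(\<lambda>\<omega>. f (\<xi> \<omega>) (\<eta> \<omega>)) \<in> M \<rightarrow>\<^sub>M T"
  using measurable_compose[OF generic, of "case_prod f" T] assms by (simp add: Pi_iff split_beta)

lemma measurable_fun_copy:
  assumes "k \<ge> 1" "\<And>x y. f x y \<in> space T"
  shows "(\<lambda>\<omega>. f (\<xi>s k \<omega>) (\<eta>s k \<omega>)) \<in> M \<rightarrow>\<^sub>M T"
  using measurable_compose[OF copy_measurable[OF assms(1)], of "case_prod f" T] assms by (simp add: Pi_iff split_beta)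

lemma measurable_generic [measurable]:
  "\<xi> \<in> M \<rightarrow>\<^sub>M count_space UNIV" "\<eta> \<in> M \<rightarrow>\<^sub>M count_space UNIV"
  using measurable_fun_generic[of "\<lambda>x y. x" "count_space UNIV"]
    measurable_fun_generic[of "\<lambda>x y. y" "count_space UNIV"] by auto

lemma measurable_copy [measurable (raw)]:
  "k \<ge> 1 \<Longrightarrow> \<xi>s k \<in> M \<rightarrow>\<^sub>M count_space UNIV" "k \<ge> 1 \<Longrightarrow> \<eta>s k \<in> M \<rightarrow>\<^sub>M count_space UNIV"
  using measurable_fun_copy[of k "\<lambda>x y. x" "count_space UNIV"]
    measurable_fun_copy[of k "\<lambda>x y. y" "count_space UNIV"] by auto

lemma distr_copy:
  assumes "k \<ge> 1" "\<And>x y. f x y \<in> space T"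
  shows "distr M T (\<lambda>\<omega>. f (\<xi>s k \<omega>) (\<eta>s k \<omega>)) = distr M T (\<lambda>\<omega>. f (\<xi> \<omega>) (\<eta> \<omega>))"
proof -
  have "distr M T (\<lambda>\<omega>. f (\<xi>s k \<omega>) (\<eta>s k \<omega>)) = distr (distr M posnat2 (\<lambda>\<omega>. (\<xi>s k \<omega>, \<eta>s k \<omega>))) T (case_prod f)"
    using assms by (subst distr_distr[OF _ copy_measurable]) (auto simp: comp_def)
  also have "\<dots> = distr M T (\<lambda>\<omega>. f (\<xi> \<omega>) (\<eta> \<omega>))"
    unfolding copies[OF assms(1)] using assms by (subst distr_distr[OF _ generic]) (auto simp: comp_def)
  finally show ?thesis .
qed

lemma nn_integral_copy:
  fixes h :: "nat \<Rightarrow> nat \<Rightarrow> ennreal"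
  assumes "k \<ge> 1"
  shows "(\<integral>\<^sup>+\<omega>. h (\<xi>s k \<omega>) (\<eta>s k \<omega>) \<partial>M) = (\<integral>\<^sup>+\<omega>. h (\<xi> \<omega>) (\<eta> \<omega>) \<partial>M)"
proof -
  have "(\<integral>\<^sup>+\<omega>. h (\<xi>s k \<omega>) (\<eta>s k \<omega>) \<partial>M) = (\<integral>\<^sup>+x. x \<partial>distr M borel (\<lambda>\<omega>. h (\<xi>s k \<omega>) (\<eta>s k \<omega>)))"
    by (rule nn_integral_distr[symmetric]) (auto intro: measurable_fun_copy[OF assms])
  also have "\<dots> = (\<integral>\<^sup>+x. x \<partial>distr M borel (\<lambda>\<omega>. h (\<xi> \<omega>) (\<eta> \<omega>)))"
    using distr_copy[OF assms, of h borel] by simp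
  also have "\<dots> = (\<integral>\<^sup>+\<omega>. h (\<xi> \<omega>) (\<eta> \<omega>) \<partial>M)"
    by (rule nn_integral_distr) (auto intro: measurable_fun_generic)
  finally show ?thesis .
qed

lemma residual_measurable [measurable]:
  assumes "k \<ge> 1"
  shows "residual p \<xi>s \<eta>s k m \<in> M \<rightarrow>\<^sub>M count_space UNIV"
  using assms unfolding residual_def[abs_def] by measurable

lemma nn_integral_residual_Suc:
  fixes h :: "nat \<Rightarrow> ennreal"
  assumes k: "k \<ge> 1"
  shows "(\<integral>\<^sup>+\<omega>. h (residual p \<xi>s \<eta>s k (Suc m) \<omega>) \<partial>M)
    = (\<integral>\<^sup>+\<omega>. \<integral>\<^sup>+\<omega>'. h (residual p \<xi>s \<eta>s k m \<omega> - multiplicity p (\<xi> \<omega>')) \<partial>M \<partial>M)"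
proof -
  let ?A = "{k..k+m}" and ?B = "{Suc (k+m)}"
  let ?V = "\<lambda>i \<omega>. (\<xi>s i \<omega>, \<eta>s i \<omega>)"
  let ?f = "\<lambda>v. multiplicity p (snd (v k)) - multiplicity p (fst (v k)) - (\<Sum>i\<in>{k<..k+m}. multiplicity p (fst (v i)))"
  let ?g = "\<lambda>v :: nat \<Rightarrow> nat \<times> nat. multiplicity p (fst (v (Suc (k+m))))"
  have comp: "(\<lambda>v. f (v i)) \<in> PiM I (\<lambda>_. posnat2) \<rightarrow>\<^sub>M count_space UNIV" if "i \<in> I" for f :: "nat \<times> nat \<Rightarrow> nat" and i I
    by (rule measurable_compose[OF measurable_component_singleton[OF that]]) simp
  have "indep_var (count_space UNIV) (?f \<circ> (\<lambda>\<omega>. restrict (\<lambda>i. ?V i \<omega>) ?A))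
      (count_space UNIV) (?g \<circ> (\<lambda>\<omega>. restrict (\<lambda>i. ?V i \<omega>) ?B))"
  proof (rule indep_var_compose[OF indep_var_restrict[OF indep]])
    have sumK: "(\<lambda>v. \<Sum>i\<in>K. multiplicity p (fst (v i))) \<in> PiM ?A (\<lambda>_. posnat2) \<rightarrow>\<^sub>M count_space UNIV"
      if "finite K" "K \<subseteq> ?A" for K
      using that
    proof (induction K)
      case (insert i K)
      then show ?case
        using measurable_binop_nat[where F="(+)", OF comp[of i ?A "\<lambda>z. multiplicity p (fst z)"]] by simp
    qed simp
    have sum: "(\<lambda>v. \<Sum>i\<in>{k<..k+m}. multiplicity p (fst (v i))) \<in> PiM ?A (\<lambda>_. posnat2) \<rightarrow>\<^sub>M count_space UNIV"
      by (rule sumK) auto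
    have kA: "k \<in> ?A" by simp
    show "?f \<in> PiM ?A (\<lambda>_. posnat2) \<rightarrow>\<^sub>M count_space UNIV"
      by (rule measurable_binop_nat[where F="(-)", OF measurable_binop_nat[where F="(-)",
          OF comp[OF kA, of "\<lambda>z. multiplicity p (snd z)"] comp[OF kA, of "\<lambda>z. multiplicity p (fst z)"]] sum])
    show "?g \<in> PiM ?B (\<lambda>_. posnat2) \<rightarrow>\<^sub>M count_space UNIV"
      using comp[of "Suc (k+m)" ?B "\<lambda>z. multiplicity p (fst z)"] by auto
  qed (use k in auto)
  moreover have "?f \<circ> (\<lambda>\<omega>. restrict (\<lambda>i. ?V i \<omega>) ?A) = residual p \<xi>s \<eta>s k m"
    by (auto simp: residual_def fun_eq_iff intro!: arg_cong2[where f="(-)"] sum.cong)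
  moreover have "?g \<circ> (\<lambda>\<omega>. restrict (\<lambda>i. ?V i \<omega>) ?B) = (\<lambda>\<omega>. multiplicity p (\<xi>s (Suc (k+m)) \<omega>))"
    by (auto simp: fun_eq_iff)
  ultimately have ind: "indep_var (count_space UNIV) (residual p \<xi>s \<eta>s k m)
      (count_space UNIV) (\<lambda>\<omega>. multiplicity p (\<xi>s (Suc (k+m)) \<omega>))"
    by simp
  have "residual p \<xi>s \<eta>s k (Suc m) \<omega> = residual p \<xi>s \<eta>s k m \<omega> - multiplicity p (\<xi>s (Suc (k+m)) \<omega>)" for \<omega>
  proof -
    have "{k<..k + Suc m} = insert (Suc (k+m)) {k<..k+m}" by auto
    then show ?thesis by (simp add: residual_def)
  qed
  then have "(\<integral>\<^sup>+\<omega>. h (residual p \<xi>s \<eta>s k (Suc m) \<omega>) \<partial>M)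
    = (\<integral>\<^sup>+\<omega>. h (residual p \<xi>s \<eta>s k m \<omega> - multiplicity p (\<xi>s (Suc (k+m)) \<omega>)) \<partial>M)" by simp
  also have "\<dots> = (\<integral>\<^sup>+\<omega>. \<integral>\<^sup>+\<omega>'. h (residual p \<xi>s \<eta>s k m \<omega> - multiplicity p (\<xi>s (Suc (k+m)) \<omega>')) \<partial>M \<partial>M)"
    by (rule nn_integral_indep_var[OF ind, of "\<lambda>x y. h (x - y)"]) (simp add: pair_measure_countable)
  also have "\<dots> = (\<integral>\<^sup>+\<omega>. \<integral>\<^sup>+\<omega>'. h (residual p \<xi>s \<eta>s k m \<omega> - multiplicity p (\<xi> \<omega>')) \<partial>M \<partial>M)"
    by (intro nn_integral_cong nn_integral_copy[of _ "\<lambda>x y. h (_ - multiplicity p x)"]) auto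
  finally show ?thesis .
qed

lemma nn_integral_residual_0:
  fixes h :: "nat \<Rightarrow> ennreal"
  assumes "k \<ge> 1"
  shows "(\<integral>\<^sup>+\<omega>. h (residual p \<xi>s \<eta>s k 0 \<omega>) \<partial>M)
    = (\<integral>\<^sup>+\<omega>. h (multiplicity p (\<eta> \<omega>) - multiplicity p (\<xi> \<omega>)) \<partial>M)"
  using nn_integral_copy[OF assms, of "\<lambda>x y. h (multiplicity p y - multiplicity p x)"]
  by (simp add: residual_def)

text \<open>The law of the residual depends on the number \<open>m\<close> of payments only. This replaces the usual reversal
  of the order of the pairs: the residuals of all \<open>k\<close> can be treated as one decreasing sequence.\<close>

lemma nn_integral_residual_shift:
  fixes h :: "nat \<Rightarrow> ennreal"
  assumes "k \<ge> 1"
  shows "(\<integral>\<^sup>+\<omega>. h (residual p \<xi>s \<eta>s k m \<omega>) \<partial>M) = (\<integral>\<^sup>+\<omega>. h (residual p \<xi>s \<eta>s 1 m \<omega>) \<partial>M)"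
proof (induction m arbitrary: h)
  case 0 show ?case using assms by (simp only: nn_integral_residual_0 order_refl)
next
  case (Suc m)
  show ?case
    using assms Suc[of "\<lambda>x. \<integral>\<^sup>+\<omega>'. h (x - multiplicity p (\<xi> \<omega>')) \<partial>M"]
    by (simp only: nn_integral_residual_Suc order_refl)
qed

lemma ennreal_excess: "ennreal (excess p \<xi> \<eta> \<omega>) = of_nat (multiplicity p (\<eta> \<omega>) - multiplicity p (\<xi> \<omega>))"
  by (auto simp: excess_def ennreal_of_nat_eq_real_of_nat max_def of_nat_diff)

lemma ennreal_excess_sq: "ennreal ((excess p \<xi> \<eta> \<omega>)\<^sup>2) = of_nat ((multiplicity p (\<eta> \<omega>) - multiplicity p (\<xi> \<omega>))\<^sup>2)"
  by (auto simp: excess_def ennreal_of_nat_eq_real_of_nat max_def of_nat_diff)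

text \<open>The triangular number \<open>\<phi> x = x (x + 1) / 2\<close> is a Lyapunov function for the residual: a payment of
  at least 1 lowers it by at least \<open>x\<close>, and a payment is made with the probability that \<open>p\<close> divides
  \<open>\<xi>\<close>, independently of the current residual.\<close>

lemma residual_drift:
  fixes p m
  defines "\<phi> \<equiv> \<lambda>x. of_nat (\<Sum>{..x}) :: ennreal"
  shows "(\<integral>\<^sup>+\<omega>. \<phi> (residual p \<xi>s \<eta>s 1 (Suc m) \<omega>) \<partial>M)
     + emeasure M {\<omega>\<in>space M. multiplicity p (\<xi> \<omega>) > 0} * (\<integral>\<^sup>+\<omega>. of_nat (residual p \<xi>s \<eta>s 1 m \<omega>) \<partial>M)
    \<le> (\<integral>\<^sup>+\<omega>. \<phi> (residual p \<xi>s \<eta>s 1 m \<omega>) \<partial>M)"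
proof -
  let ?S = "{\<omega>\<in>space M. multiplicity p (\<xi> \<omega>) > 0}"
  have nat: "(\<Sum>{..x - b}) + x \<le> \<Sum>{..x}" if "b > 0" for x b :: nat
  proof (cases x)
    case (Suc y)
    then have "(\<Sum>{..x - b}) \<le> \<Sum>{..y}" using that by (intro sum_mono2) auto
    then show ?thesis using Suc by simp
  qed simp
  have nat0: "(\<Sum>{..x - b}) \<le> \<Sum>{..x}" for x b :: nat by (intro sum_mono2) auto
  have [measurable]: "?S \<in> sets M" by measurable
  have step: "(\<integral>\<^sup>+\<omega>'. \<phi> (x - multiplicity p (\<xi> \<omega>')) \<partial>M) + emeasure M ?S * of_nat x \<le> \<phi> x" for x
  proof -
    have "(\<integral>\<^sup>+\<omega>'. \<phi> (x - multiplicity p (\<xi> \<omega>')) \<partial>M) + emeasure M ?S * of_nat x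
      = (\<integral>\<^sup>+\<omega>'. \<phi> (x - multiplicity p (\<xi> \<omega>')) + of_nat x * indicator ?S \<omega>' \<partial>M)"
      by (subst nn_integral_add) (auto simp: nn_integral_cmult mult.commute)
    also have "\<dots> \<le> (\<integral>\<^sup>+\<omega>'. \<phi> x \<partial>M)"
    proof (rule nn_integral_mono)
      fix \<omega>' assume "\<omega>' \<in> space M"
      then show "\<phi> (x - multiplicity p (\<xi> \<omega>')) + of_nat x * indicator ?S \<omega>' \<le> \<phi> x"
        using nat[of "multiplicity p (\<xi> \<omega>')" x] nat0[of x "multiplicity p (\<xi> \<omega>')"]
        unfolding \<phi>_def by (auto simp: indicator_def of_nat_add[symmetric] simp del: of_nat_add of_nat_sum)
    qed
    also have "\<dots> = \<phi> x" by (simp add: emeasure_space_1)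
    finally show ?thesis .
  qed
  have "(\<integral>\<^sup>+\<omega>. \<phi> (residual p \<xi>s \<eta>s 1 (Suc m) \<omega>) \<partial>M) + emeasure M ?S * (\<integral>\<^sup>+\<omega>. of_nat (residual p \<xi>s \<eta>s 1 m \<omega>) \<partial>M)
    = (\<integral>\<^sup>+\<omega>. (\<integral>\<^sup>+\<omega>'. \<phi> (residual p \<xi>s \<eta>s 1 m \<omega> - multiplicity p (\<xi> \<omega>')) \<partial>M)
         + emeasure M ?S * of_nat (residual p \<xi>s \<eta>s 1 m \<omega>) \<partial>M)"
  proof (subst nn_integral_add)
    show "(\<lambda>\<omega>. \<integral>\<^sup>+\<omega>'. \<phi> (residual p \<xi>s \<eta>s 1 m \<omega> - multiplicity p (\<xi> \<omega>')) \<partial>M) \<in> borel_measurable M"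
      by (rule measurable_compose[OF residual_measurable, of 1 "\<lambda>x. \<integral>\<^sup>+\<omega>'. \<phi> (x - multiplicity p (\<xi> \<omega>')) \<partial>M"]) auto
  qed (auto simp: nn_integral_cmult nn_integral_residual_Suc simp del: One_nat_def)
  also have "\<dots> \<le> (\<integral>\<^sup>+\<omega>. \<phi> (residual p \<xi>s \<eta>s 1 m \<omega>) \<partial>M)"
    by (intro nn_integral_mono step)
  finally show ?thesis .
qed

lemma sum_residual_eq:
  "(\<Sum>k\<in>{1..n}. \<integral>\<^sup>+\<omega>. of_nat (residual p \<xi>s \<eta>s k (n - k) \<omega>) \<partial>M)
    = (\<Sum>m<n. \<integral>\<^sup>+\<omega>. of_nat (residual p \<xi>s \<eta>s 1 m \<omega>) \<partial>M)"
proof -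
  have "(\<Sum>k\<in>{1..n}. \<integral>\<^sup>+\<omega>. of_nat (residual p \<xi>s \<eta>s k (n - k) \<omega>) \<partial>M)
    = (\<Sum>k\<in>{1..n}. \<integral>\<^sup>+\<omega>. of_nat (residual p \<xi>s \<eta>s 1 (n - k) \<omega>) \<partial>M)"
    by (intro sum.cong refl nn_integral_residual_shift) auto
  also have "\<dots> = (\<Sum>m<n. \<integral>\<^sup>+\<omega>. of_nat (residual p \<xi>s \<eta>s 1 (n - Suc m) \<omega>) \<partial>M)"
    unfolding One_nat_def sum.atLeast1_atMost_eq ..
  also have "\<dots> = (\<Sum>m<n. \<integral>\<^sup>+\<omega>. of_nat (residual p \<xi>s \<eta>s 1 m \<omega>) \<partial>M)"
    by (rule sum.nat_diff_reindex)
  finally show ?thesis .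
qed

text \<open>Summing the drift inequality over \<open>m\<close> telescopes, and \<open>\<phi> x \<le> x\<^sup>2\<close> for natural \<open>x\<close>.
  The bound does not depend on \<open>n\<close>, which makes it the useful one for primes that divide \<open>\<xi>\<close> often.\<close>

lemma sum_residual_le_second_moment:
  "emeasure M {\<omega>\<in>space M. multiplicity p (\<xi> \<omega>) > 0}
     * (\<Sum>k\<in>{1..n}. \<integral>\<^sup>+\<omega>. of_nat (residual p \<xi>s \<eta>s k (n - k) \<omega>) \<partial>M)
   \<le> (\<integral>\<^sup>+\<omega>. ennreal ((excess p \<xi> \<eta> \<omega>)\<^sup>2) \<partial>M)"
proof -
  let ?q = "emeasure M {\<omega>\<in>space M. multiplicity p (\<xi> \<omega>) > 0}"
  define \<phi> :: "nat \<Rightarrow> ennreal" where "\<phi> x = of_nat (\<Sum>{..x})" for x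
  have "?q * (\<Sum>m<n. \<integral>\<^sup>+\<omega>. of_nat (residual p \<xi>s \<eta>s 1 m \<omega>) \<partial>M)
     + (\<integral>\<^sup>+\<omega>. \<phi> (residual p \<xi>s \<eta>s 1 n \<omega>) \<partial>M) \<le> (\<integral>\<^sup>+\<omega>. \<phi> (residual p \<xi>s \<eta>s 1 0 \<omega>) \<partial>M)" for n
  proof (induction n)
    case (Suc n)
    have "?q * (\<Sum>m<Suc n. \<integral>\<^sup>+\<omega>. of_nat (residual p \<xi>s \<eta>s 1 m \<omega>) \<partial>M) + (\<integral>\<^sup>+\<omega>. \<phi> (residual p \<xi>s \<eta>s 1 (Suc n) \<omega>) \<partial>M)
      = ?q * (\<Sum>m<n. \<integral>\<^sup>+\<omega>. of_nat (residual p \<xi>s \<eta>s 1 m \<omega>) \<partial>M)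
        + ((\<integral>\<^sup>+\<omega>. \<phi> (residual p \<xi>s \<eta>s 1 (Suc n) \<omega>) \<partial>M) + ?q * (\<integral>\<^sup>+\<omega>. of_nat (residual p \<xi>s \<eta>s 1 n \<omega>) \<partial>M))"
      by (simp add: distrib_left ac_simps)
    also have "\<dots> \<le> ?q * (\<Sum>m<n. \<integral>\<^sup>+\<omega>. of_nat (residual p \<xi>s \<eta>s 1 m \<omega>) \<partial>M) + (\<integral>\<^sup>+\<omega>. \<phi> (residual p \<xi>s \<eta>s 1 n \<omega>) \<partial>M)"
      unfolding \<phi>_def by (intro add_left_mono residual_drift)
    finally show ?case using Suc.IH by (rule order_trans)
  qed simp
  note main = this[of n]
  have "?q * (\<Sum>m<n. \<integral>\<^sup>+\<omega>. of_nat (residual p \<xi>s \<eta>s 1 m \<omega>) \<partial>M)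
     \<le> ?q * (\<Sum>m<n. \<integral>\<^sup>+\<omega>. of_nat (residual p \<xi>s \<eta>s 1 m \<omega>) \<partial>M)
     + (\<integral>\<^sup>+\<omega>. \<phi> (residual p \<xi>s \<eta>s 1 n \<omega>) \<partial>M)"
    by simp
  also have "\<dots> \<le> (\<integral>\<^sup>+\<omega>. \<phi> (residual p \<xi>s \<eta>s 1 0 \<omega>) \<partial>M)" by (rule main)
  also have "\<dots> = (\<integral>\<^sup>+\<omega>. \<phi> (multiplicity p (\<eta> \<omega>) - multiplicity p (\<xi> \<omega>)) \<partial>M)"
    by (rule nn_integral_residual_0) simp
  also have "\<dots> \<le> (\<integral>\<^sup>+\<omega>. ennreal ((excess p \<xi> \<eta> \<omega>)\<^sup>2) \<partial>M)"
  proof (rule nn_integral_mono)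
    have "(\<Sum>{..x}) \<le> x\<^sup>2" for x :: nat
      by (induction x) (auto simp: power2_eq_square)
    then show "\<phi> (multiplicity p (\<eta> \<omega>) - multiplicity p (\<xi> \<omega>)) \<le> ennreal ((excess p \<xi> \<eta> \<omega>)\<^sup>2)" for \<omega>
      unfolding \<phi>_def ennreal_excess_sq by (simp only: of_nat_le_iff)
  qed
  finally show ?thesis unfolding sum_residual_eq .
qed

text \<open>The crude bound that ignores all payments; it serves for the primes that rarely divide \<open>\<xi>\<close>.\<close>

lemma sum_residual_le_first_moment:
  "(\<Sum>k\<in>{1..n}. \<integral>\<^sup>+\<omega>. of_nat (residual p \<xi>s \<eta>s k (n - k) \<omega>) \<partial>M)
   \<le> of_nat n * (\<integral>\<^sup>+\<omega>. ennreal (excess p \<xi> \<eta> \<omega>) \<partial>M)"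
proof -
  have "(\<integral>\<^sup>+\<omega>. of_nat (residual p \<xi>s \<eta>s k (n - k) \<omega>) \<partial>M) \<le> (\<integral>\<^sup>+\<omega>. ennreal (excess p \<xi> \<eta> \<omega>) \<partial>M)"
    if "k \<in> {1..n}" for k
  proof -
    have "(\<integral>\<^sup>+\<omega>. of_nat (residual p \<xi>s \<eta>s k (n - k) \<omega>) \<partial>M)
      \<le> (\<integral>\<^sup>+\<omega>. of_nat (residual p \<xi>s \<eta>s k 0 \<omega>) \<partial>M)"
      by (intro nn_integral_mono) (auto simp: residual_def intro!: of_nat_mono)
    also have "\<dots> = (\<integral>\<^sup>+\<omega>. ennreal (excess p \<xi> \<eta> \<omega>) \<partial>M)"
      unfolding ennreal_excess using that by (intro nn_integral_residual_0) auto
    finally show ?thesis .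
  qed
  then have "(\<Sum>k\<in>{1..n}. \<integral>\<^sup>+\<omega>. of_nat (residual p \<xi>s \<eta>s k (n - k) \<omega>) \<partial>M)
     \<le> (\<Sum>k\<in>{1..n}. \<integral>\<^sup>+\<omega>. ennreal (excess p \<xi> \<eta> \<omega>) \<partial>M)"
    by (rule sum_mono)
  then show ?thesis by simp
qed

section \<open>The logarithmic gap between the least common multiple and the product\<close>

lemma Pi_walk_measurable [measurable]: "Pi_walk \<xi>s n \<in> M \<rightarrow>\<^sub>M count_space UNIV"
proof (induction n)
  case (Suc n)
  have "Pi_walk \<xi>s (Suc n) = (\<lambda>\<omega>. Pi_walk \<xi>s n \<omega> * \<xi>s (Suc n) \<omega>)"
    by (auto simp: Pi_walk_def)
  then show ?case
    using measurable_binop_nat[where F="(*)", OF Suc measurable_copy(1)[of "Suc n"]] by simp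
qed (simp add: Pi_walk_def)

lemma L_lcm_measurable [measurable]: "L_lcm \<xi>s \<eta>s n \<in> M \<rightarrow>\<^sub>M count_space UNIV"
proof (induction n)
  case (Suc n)
  have "L_lcm \<xi>s \<eta>s (Suc n) = (\<lambda>\<omega>. lcm (Pi_walk \<xi>s n \<omega> * \<eta>s (Suc n) \<omega>) (L_lcm \<xi>s \<eta>s n \<omega>))"
  proof
    fix \<omega>
    have "{1..Suc n} = insert (Suc n) {1..n}" by auto
    then show "L_lcm \<xi>s \<eta>s (Suc n) \<omega> = lcm (Pi_walk \<xi>s n \<omega> * \<eta>s (Suc n) \<omega>) (L_lcm \<xi>s \<eta>s n \<omega>)"
      unfolding L_lcm_def by (simp add: Theta_def)
  qed
  then show ?case
    using measurable_binop_nat[where F=lcm, OF measurable_binop_nat[where F="(*)",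
        OF Pi_walk_measurable measurable_copy(2)[of "Suc n"]] Suc] by simp
qed (simp add: L_lcm_def)

definition gap :: "nat \<Rightarrow> 'a \<Rightarrow> real" where
  "gap n \<omega> = ln (real (L_lcm \<xi>s \<eta>s n \<omega>)) - ln (real (Pi_walk \<xi>s n \<omega>))"

lemma gap_measurable [measurable]: "gap n \<in> borel_measurable M"
  unfolding gap_def[abs_def] by measurable

text \<open>The first summand bounds the negative part of the gap, the second one the positive part.\<close>

lemma nn_integral_abs_gap_le:
  "(\<integral>\<^sup>+\<omega>. ennreal \<bar>gap n \<omega>\<bar> \<partial>M) \<le> (\<integral>\<^sup>+\<omega>. ennreal (ln (real (\<xi> \<omega>))) \<partial>M)
     + (\<integral>\<^sup>+p. (\<Sum>k\<in>{1..n}. \<integral>\<^sup>+\<omega>. of_nat (residual p \<xi>s \<eta>s k (n - k) \<omega>) \<partial>M) * ennreal (ln (real p))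
          \<partial>count_space {p. prime p})"
proof -
  have "(\<integral>\<^sup>+\<omega>. ennreal (gap n \<omega>) \<partial>M)
    \<le> (\<integral>\<^sup>+\<omega>. \<integral>\<^sup>+p. of_nat (\<Sum>k\<in>{1..n}. residual p \<xi>s \<eta>s k (n - k) \<omega>) * ennreal (ln (real p))
          \<partial>count_space {p. prime p} \<partial>M)"
    unfolding gap_def
    by (intro nn_integral_mono ln_diff_le_nn_integral_primes L_lcm_pos Pi_walk_pos multiplicity_L_lcm_le)
       (auto intro: copy_pos)
  also have "\<dots> = (\<integral>\<^sup>+p. \<integral>\<^sup>+\<omega>. of_nat (\<Sum>k\<in>{1..n}. residual p \<xi>s \<eta>s k (n - k) \<omega>) * ennreal (ln (real p)) \<partial>M
          \<partial>count_space {p. prime p})"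
    by (rule nn_integral_count_space_nn_integral) auto
  also have "\<dots> = (\<integral>\<^sup>+p. (\<Sum>k\<in>{1..n}. \<integral>\<^sup>+\<omega>. of_nat (residual p \<xi>s \<eta>s k (n - k) \<omega>) \<partial>M) * ennreal (ln (real p))
          \<partial>count_space {p. prime p})"
  proof (rule nn_integral_cong)
    fix p
    have "(\<integral>\<^sup>+\<omega>. of_nat (\<Sum>k\<in>{1..n}. residual p \<xi>s \<eta>s k (n - k) \<omega>) * ennreal (ln (real p)) \<partial>M)
      = (\<integral>\<^sup>+\<omega>. (\<Sum>k\<in>{1..n}. of_nat (residual p \<xi>s \<eta>s k (n - k) \<omega>)) \<partial>M) * ennreal (ln (real p))"
      unfolding of_nat_sum by (rule nn_integral_multc) auto
    also have "(\<integral>\<^sup>+\<omega>. (\<Sum>k\<in>{1..n}. of_nat (residual p \<xi>s \<eta>s k (n - k) \<omega>)) \<partial>M)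
      = (\<Sum>k\<in>{1..n}. \<integral>\<^sup>+\<omega>. of_nat (residual p \<xi>s \<eta>s k (n - k) \<omega>) \<partial>M)"
      by (rule nn_integral_sum) auto
    finally show "(\<integral>\<^sup>+\<omega>. of_nat (\<Sum>k\<in>{1..n}. residual p \<xi>s \<eta>s k (n - k) \<omega>) * ennreal (ln (real p)) \<partial>M)
      = (\<Sum>k\<in>{1..n}. \<integral>\<^sup>+\<omega>. of_nat (residual p \<xi>s \<eta>s k (n - k) \<omega>) \<partial>M) * ennreal (ln (real p))" .
  qed
  finally have upper: "(\<integral>\<^sup>+\<omega>. ennreal (gap n \<omega>) \<partial>M) \<le> \<dots>" .
  have lower: "(\<integral>\<^sup>+\<omega>. ennreal (- gap n \<omega>) \<partial>M) \<le> (\<integral>\<^sup>+\<omega>. ennreal (ln (real (\<xi> \<omega>))) \<partial>M)"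
  proof (cases "n = 0")
    case True
    then show ?thesis by (simp add: gap_def L_lcm_def Pi_walk_def)
  next
    case False
    then have n: "n \<ge> 1" by simp
    have "(\<integral>\<^sup>+\<omega>. ennreal (- gap n \<omega>) \<partial>M) \<le> (\<integral>\<^sup>+\<omega>. ennreal (ln (real (\<xi>s n \<omega>))) \<partial>M)"
    proof (intro nn_integral_mono ennreal_leI)
      fix \<omega> assume \<omega>: "\<omega> \<in> space M"
      have "ln (real (Pi_walk \<xi>s n \<omega>)) \<le> ln (real (L_lcm \<xi>s \<eta>s n \<omega>)) + ln (real (\<xi>s n \<omega>))"
        using \<omega> n by (intro ln_Pi_walk_le_ln_L_lcm copy_pos) auto
      then show "- gap n \<omega> \<le> ln (real (\<xi>s n \<omega>))" by (simp add: gap_def)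
    qed
    also have "\<dots> = (\<integral>\<^sup>+\<omega>. ennreal (ln (real (\<xi> \<omega>))) \<partial>M)"
      using nn_integral_copy[OF n, of "\<lambda>x y. ennreal (ln (real x))"] .
    finally show ?thesis .
  qed
  have "(\<integral>\<^sup>+\<omega>. ennreal \<bar>gap n \<omega>\<bar> \<partial>M) = (\<integral>\<^sup>+\<omega>. ennreal (- gap n \<omega>) + ennreal (gap n \<omega>) \<partial>M)"
    by (intro nn_integral_cong) (auto simp: abs_if ennreal_neg)
  also have "\<dots> = (\<integral>\<^sup>+\<omega>. ennreal (- gap n \<omega>) \<partial>M) + (\<integral>\<^sup>+\<omega>. ennreal (gap n \<omega>) \<partial>M)"
    by (rule nn_integral_add) auto
  also note add_mono[OF lower upper]
  finally show ?thesis .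
qed

text \<open>For each fixed prime the term tends to 0, and the threshold that defines \<open>primes1\<close> says exactly that
  the factor in front of \<open>w p\<close> is at most 1 as long as \<open>p\<close> contributes. So dominated convergence over
  the primes applies with \<open>w\<close> itself as the majorant.\<close>

lemma tendsto_frequent_primes:
  assumes w: "(\<integral>\<^sup>+p. w p \<partial>count_space {p. prime p}) < \<infinity>"
  shows "(\<lambda>n. \<integral>\<^sup>+p. (if p \<in> primes1 M \<xi> n
      then ennreal (1 / (measure M {\<omega> \<in> space M. multiplicity p (\<xi> \<omega>) > 0} * sqrt (real n))) * w p else 0)
    \<partial>count_space {p. prime p}) \<longlonglongrightarrow> 0"
proof -
  define q where "q p = measure M {\<omega> \<in> space M. multiplicity p (\<xi> \<omega>) > 0}" for p
  let ?f = "\<lambda>n p. if p \<in> primes1 M \<xi> n then ennreal (1 / (q p * sqrt (real n))) * w p else 0"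
  have "(\<lambda>n. \<integral>\<^sup>+p. ?f n p \<partial>count_space {p. prime p}) \<longlonglongrightarrow> (\<integral>\<^sup>+p. 0 \<partial>count_space {p::nat. prime p})"
  proof (rule nn_integral_dominated_convergence[where w=w])
    show "AE p in count_space {p. prime p}. ?f n p \<le> w p" for n
    proof (rule AE_I2)
      fix p :: nat
      have "1 / (q p * sqrt (real n)) \<le> 1" if p: "p \<in> primes1 M \<xi> n" and "n \<noteq> 0"
      proof -
        have "1 = real n powr (- 1 / 2) * sqrt (real n)"
          using \<open>n \<noteq> 0\<close> by (simp add: powr_half_sqrt[symmetric] powr_add[symmetric])
        also have "\<dots> \<le> q p * sqrt (real n)"
          using p by (intro mult_right_mono) (auto simp: primes1_def q_def)
        finally show ?thesis by (simp add: divide_le_eq)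
      qed
      then have "ennreal (1 / (q p * sqrt (real n))) \<le> 1" if "p \<in> primes1 M \<xi> n"
        using that by (cases "n = 0") auto
      then show "?f n p \<le> w p"
        using mult_right_mono[of "ennreal (1 / (q p * sqrt (real n)))" 1 "w p"] by auto
    qed
    show "AE p in count_space {p. prime p}. (\<lambda>n. ?f n p) \<longlonglongrightarrow> 0"
    proof (subst AE_count_space, intro ballI)
      fix p :: nat assume p: "p \<in> {p. prime p}"
      have fin: "w p < top"
      proof -
        have "w p \<noteq> \<infinity>"
          using nn_integral_PInf_AE[of w "count_space {p. prime p}"] w p by (auto simp: AE_count_space)
        then show ?thesis by (simp add: less_top)
      qed
      have "(\<lambda>n. 1 / q p * (1 / sqrt (real n))) \<longlonglongrightarrow> 1 / q p * 0"
        by (intro tendsto_mult tendsto_const real_tendsto_divide_at_top[OF tendsto_const] filterlim_compose[OF sqrt_at_top] filterlim_real_sequentially)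
      then have "(\<lambda>n. ennreal (1 / (q p * sqrt (real n)))) \<longlonglongrightarrow> ennreal 0"
        by (intro tendsto_ennrealI) simp
      from ennreal_tendsto_cmult[OF fin this]
      have lim: "(\<lambda>n. ennreal (1 / (q p * sqrt (real n))) * w p) \<longlonglongrightarrow> 0" by (simp add: mult.commute)
      show "(\<lambda>n. ?f n p) \<longlonglongrightarrow> 0"
        by (rule tendsto_sandwich[OF _ _ tendsto_const lim]) auto
    qed
  qed (use w in auto)
  then show ?thesis unfolding q_def by simp
qed

text \<open>The second-moment bound is applied to the primes in \<open>primes1\<close> and the first-moment bound to those in
  \<open>primes2\<close>. After division by \<open>sqrt n\<close> the latter contribute precisely the quantity that the second
  excess condition sends to 0.\<close>

theorem tendsto_expected_gap:
  assumes log_xi: "integrable M (\<lambda>\<omega>. ln (real (\<xi> \<omega>)))"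
    and prime_pos: "\<And>p. prime p \<Longrightarrow> measure M {\<omega> \<in> space M. multiplicity p (\<xi> \<omega>) > 0} > 0"
    and excess_sq: "(\<Sum>\<^sub>\<infinity>p\<in>{p. prime p}.
          (\<integral>\<^sup>+\<omega>. ennreal ((excess p \<xi> \<eta> \<omega>)\<^sup>2) \<partial>M) * ennreal (ln (real p))) < \<infinity>"
    and excess_P2: "(\<lambda>n. (\<Sum>\<^sub>\<infinity>p\<in>primes2 M \<xi> n.
          (\<integral>\<^sup>+\<omega>. ennreal (excess p \<xi> \<eta> \<omega>) \<partial>M) * ennreal (ln (real p)))
            / ennreal (real n powr (- 1 / 2))) \<longlonglongrightarrow> 0"
  shows "(\<lambda>n. (\<integral>\<^sup>+\<omega>. ennreal \<bar>gap n \<omega>\<bar> \<partial>M) * ennreal (1 / sqrt (real n))) \<longlonglongrightarrow> 0"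
proof -
  define q where "q p = measure M {\<omega> \<in> space M. multiplicity p (\<xi> \<omega>) > 0}" for p
  define C where "C = (\<integral>\<^sup>+\<omega>. ennreal (ln (real (\<xi> \<omega>))) \<partial>M)"
  have "C < \<infinity>"
    using log_xi generic_pos unfolding C_def
    by (subst nn_integral_eq_integral) (auto intro!: AE_I2 simp: Suc_le_eq)
  define e1 where "e1 p = (\<integral>\<^sup>+\<omega>. ennreal (excess p \<xi> \<eta> \<omega>) \<partial>M) * ennreal (ln (real p))" for p
  define e2 where "e2 p = (\<integral>\<^sup>+\<omega>. ennreal ((excess p \<xi> \<eta> \<omega>)\<^sup>2) \<partial>M) * ennreal (ln (real p))" for p
  define S2 where "S2 n = (\<integral>\<^sup>+p. e1 p \<partial>count_space (primes2 M \<xi> n))" for n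
  define f where "f n p = (if p \<in> primes1 M \<xi> n then ennreal (1 / (q p * sqrt (real n))) * e2 p else 0)" for n p
  have e2_fin: "(\<integral>\<^sup>+p. e2 p \<partial>count_space {p. prime p}) < \<infinity>"
    using excess_sq by (simp add: e2_def infsum_ennreal_eq_nn_integral)
  have lim2: "(\<lambda>n. S2 n / ennreal (real n powr (- 1 / 2))) \<longlonglongrightarrow> 0"
    using excess_P2 by (simp add: S2_def e1_def infsum_ennreal_eq_nn_integral)
  have lim1: "(\<lambda>n. \<integral>\<^sup>+p. f n p \<partial>count_space {p. prime p}) \<longlonglongrightarrow> 0"
    unfolding f_def q_def using e2_fin by (rule tendsto_frequent_primes)
  have lim0: "(\<lambda>n. C * ennreal (1 / sqrt (real n))) \<longlonglongrightarrow> 0"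
  proof -
    have "(\<lambda>n. 1 / sqrt (real n)) \<longlonglongrightarrow> 0"
      by (intro real_tendsto_divide_at_top[OF tendsto_const] filterlim_compose[OF sqrt_at_top] filterlim_real_sequentially)
    then have "(\<lambda>n. ennreal (1 / sqrt (real n))) \<longlonglongrightarrow> ennreal 0" by (rule tendsto_ennrealI)
    from ennreal_tendsto_cmult[OF _ this, of C] \<open>C < \<infinity>\<close> show ?thesis by simp
  qed
  have bound: "(\<integral>\<^sup>+\<omega>. ennreal \<bar>gap n \<omega>\<bar> \<partial>M) * ennreal (1 / sqrt (real n))
     \<le> C * ennreal (1 / sqrt (real n)) + ((\<integral>\<^sup>+p. f n p \<partial>count_space {p. prime p}) + S2 n / ennreal (real n powr (- 1 / 2)))"
    if n: "n \<ge> 1" for n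
  proof -
    let ?R = "\<lambda>p. (\<Sum>k\<in>{1..n}. \<integral>\<^sup>+\<omega>. of_nat (residual p \<xi>s \<eta>s k (n - k) \<omega>) \<partial>M)"
    let ?g = "\<lambda>p. if p \<in> primes2 M \<xi> n then ennreal (sqrt (real n)) * e1 p else 0"
    have "?R p * ennreal (ln (real p)) * ennreal (1 / sqrt (real n)) \<le> f n p + ?g p" if p: "prime p" for p
    proof (cases "p \<in> primes1 M \<xi> n")
      case True
      have qp: "q p > 0" using prime_pos[OF p] by (simp add: q_def)
      have "?R p = ennreal (1 / q p) * (ennreal (q p) * ?R p)"
        using qp by (simp add: mult.assoc[symmetric] ennreal_mult[symmetric])
      also have "\<dots> \<le> ennreal (1 / q p) * (\<integral>\<^sup>+\<omega>. ennreal ((excess p \<xi> \<eta> \<omega>)\<^sup>2) \<partial>M)"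
        using sum_residual_le_second_moment[of p n]
        by (intro mult_left_mono) (auto simp: q_def emeasure_eq_measure)
      finally have "?R p * ennreal (ln (real p)) * ennreal (1 / sqrt (real n))
        \<le> ennreal (1 / q p) * (\<integral>\<^sup>+\<omega>. ennreal ((excess p \<xi> \<eta> \<omega>)\<^sup>2) \<partial>M) * ennreal (ln (real p)) * ennreal (1 / sqrt (real n))"
        by (intro mult_right_mono) auto
      also have "\<dots> = ennreal (1 / q p) * ennreal (1 / sqrt (real n)) * e2 p"
        by (simp add: e2_def ac_simps)
      also have "ennreal (1 / q p) * ennreal (1 / sqrt (real n)) = ennreal (1 / (q p * sqrt (real n)))"
        using qp by (subst ennreal_mult[symmetric]) auto
      finally show ?thesis using True by (simp add: f_def primes2_def)
    next
      case False
      then have p2: "p \<in> primes2 M \<xi> n" using p by (simp add: primes2_def)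
      have "?R p * ennreal (ln (real p)) * ennreal (1 / sqrt (real n))
        \<le> of_nat n * (\<integral>\<^sup>+\<omega>. ennreal (excess p \<xi> \<eta> \<omega>) \<partial>M) * ennreal (ln (real p)) * ennreal (1 / sqrt (real n))"
        by (intro mult_right_mono sum_residual_le_first_moment) auto
      also have "\<dots> = (of_nat n * ennreal (1 / sqrt (real n))) * e1 p"
        by (simp add: e1_def ac_simps)
      also have "of_nat n * ennreal (1 / sqrt (real n)) = ennreal (real n * (1 / sqrt (real n)))"
        by (subst ennreal_mult) (auto simp: ennreal_of_nat_eq_real_of_nat)
      also have "real n * (1 / sqrt (real n)) = sqrt (real n)"
        by (simp add: real_div_sqrt)
      finally show ?thesis using p2 False by (simp add: f_def)
    qed
    then have "(\<integral>\<^sup>+p. ?R p * ennreal (ln (real p)) * ennreal (1 / sqrt (real n)) \<partial>count_space {p. prime p})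
      \<le> (\<integral>\<^sup>+p. f n p + ?g p \<partial>count_space {p. prime p})"
      by (intro nn_integral_mono) auto
    also have "\<dots> = (\<integral>\<^sup>+p. f n p \<partial>count_space {p. prime p}) + (\<integral>\<^sup>+p. ?g p \<partial>count_space {p. prime p})"
      by (rule nn_integral_add) auto
    also have "(\<integral>\<^sup>+p. ?g p \<partial>count_space {p. prime p}) = (\<integral>\<^sup>+p. ennreal (sqrt (real n)) * e1 p \<partial>count_space (primes2 M \<xi> n))"
      by (subst (1 2) nn_integral_count_space_indicator)
         (auto simp: primes2_def indicator_def intro!: nn_integral_cong)
    also have "\<dots> = ennreal (sqrt (real n)) * S2 n"
      unfolding S2_def by (rule nn_integral_cmult) auto
    also have "\<dots> = S2 n / ennreal (real n powr (- 1 / 2))"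
      using n by (simp add: divide_ennreal_def inverse_ennreal powr_minus[symmetric] powr_half_sqrt mult.commute)
    finally have R: "(\<integral>\<^sup>+p. ?R p * ennreal (ln (real p)) * ennreal (1 / sqrt (real n)) \<partial>count_space {p. prime p})
      \<le> (\<integral>\<^sup>+p. f n p \<partial>count_space {p. prime p}) + S2 n / ennreal (real n powr (- 1 / 2))" .
    have "(\<integral>\<^sup>+\<omega>. ennreal \<bar>gap n \<omega>\<bar> \<partial>M) * ennreal (1 / sqrt (real n))
      \<le> (C + (\<integral>\<^sup>+p. ?R p * ennreal (ln (real p)) \<partial>count_space {p. prime p})) * ennreal (1 / sqrt (real n))"
      unfolding C_def by (intro mult_right_mono nn_integral_abs_gap_le) auto
    also have "\<dots> = C * ennreal (1 / sqrt (real n))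
       + (\<integral>\<^sup>+p. ?R p * ennreal (ln (real p)) * ennreal (1 / sqrt (real n)) \<partial>count_space {p. prime p})"
      by (subst nn_integral_multc) (auto simp: distrib_right)
    also have "\<dots> \<le> C * ennreal (1 / sqrt (real n)) + ((\<integral>\<^sup>+p. f n p \<partial>count_space {p. prime p}) + S2 n / ennreal (real n powr (- 1 / 2)))"
      by (intro add_left_mono R)
    finally show ?thesis .
  qed
  have "(\<lambda>n. C * ennreal (1 / sqrt (real n)) + ((\<integral>\<^sup>+p. f n p \<partial>count_space {p. prime p})
      + S2 n / ennreal (real n powr (- 1 / 2)))) \<longlonglongrightarrow> 0 + (0 + 0)"
    by (intro tendsto_add lim0 lim1 lim2)
  then have lim: "(\<lambda>n. C * ennreal (1 / sqrt (real n)) + ((\<integral>\<^sup>+p. f n p \<partial>count_space {p. prime p})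
      + S2 n / ennreal (real n powr (- 1 / 2)))) \<longlonglongrightarrow> 0"
    by simp
  show ?thesis
  proof (rule tendsto_sandwich[OF _ _ tendsto_const lim])
    show "eventually (\<lambda>n. (\<integral>\<^sup>+\<omega>. ennreal \<bar>gap n \<omega>\<bar> \<partial>M) * ennreal (1 / sqrt (real n))
      \<le> C * ennreal (1 / sqrt (real n)) + ((\<integral>\<^sup>+p. f n p \<partial>count_space {p. prime p})
        + S2 n / ennreal (real n powr (- 1 / 2)))) sequentially"
      using eventually_ge_at_top[of 1] by eventually_elim (rule bound)
  qed simp
qed

lemma tendsto_expected_gap_scaled:
  assumes lim: "(\<lambda>n. (\<integral>\<^sup>+\<omega>. ennreal \<bar>gap n \<omega>\<bar> \<partial>M) * ennreal (1 / sqrt (real n))) \<longlonglongrightarrow> 0"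
    and v: "0 \<le> v"
  shows "((\<lambda>t::real. (\<integral>\<^sup>+\<omega>. ennreal \<bar>gap (nat \<lfloor>t * v\<rfloor>) \<omega>\<bar> \<partial>M) * ennreal (1 / sqrt t)) \<longlongrightarrow> 0) at_top"
proof (cases "v = 0")
  case True
  then show ?thesis by (simp add: gap_def L_lcm_def Pi_walk_def)
next
  case False
  with v have "v > 0" by simp
  let ?n = "\<lambda>t. nat \<lfloor>t * v\<rfloor>"
  have n_top: "filterlim ?n sequentially at_top"
    by (intro filterlim_compose[OF filterlim_nat_sequentially] filterlim_compose[OF filterlim_floor_sequentially]
        filterlim_at_top_mult_tendsto_pos[OF tendsto_const \<open>v > 0\<close> filterlim_ident])
  have "((\<lambda>t. ennreal (sqrt v) * ((\<integral>\<^sup>+\<omega>. ennreal \<bar>gap (?n t) \<omega>\<bar> \<partial>M) * ennreal (1 / sqrt (real (?n t))))) \<longlongrightarrow> ennreal (sqrt v) * 0) at_top"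
    by (intro ennreal_tendsto_cmult filterlim_compose[OF lim n_top]) auto
  then have lim': "((\<lambda>t. ennreal (sqrt v) * ((\<integral>\<^sup>+\<omega>. ennreal \<bar>gap (?n t) \<omega>\<bar> \<partial>M) * ennreal (1 / sqrt (real (?n t))))) \<longlongrightarrow> 0) at_top"
    by simp
  show ?thesis
  proof (rule tendsto_sandwich[OF _ _ tendsto_const lim'])
    show "eventually (\<lambda>t. (\<integral>\<^sup>+\<omega>. ennreal \<bar>gap (?n t) \<omega>\<bar> \<partial>M) * ennreal (1 / sqrt t)
       \<le> ennreal (sqrt v) * ((\<integral>\<^sup>+\<omega>. ennreal \<bar>gap (?n t) \<omega>\<bar> \<partial>M) * ennreal (1 / sqrt (real (?n t))))) at_top"
      using eventually_ge_at_top[of "1 / v"] eventually_gt_at_top[of 0]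
    proof eventually_elim
      case (elim t)
      then have "1 \<le> t * v" using \<open>v > 0\<close> by (simp add: field_simps)
      then have pos: "0 < real (?n t)" and le: "real (?n t) \<le> t * v" by linarith+
      have "sqrt (real (?n t)) \<le> sqrt t * sqrt v"
        using le by (simp add: real_sqrt_mult[symmetric])
      then have "1 / sqrt t \<le> sqrt v * (1 / sqrt (real (?n t)))"
        using pos elim by (simp add: field_simps)
      then have "ennreal (1 / sqrt t) \<le> ennreal (sqrt v) * ennreal (1 / sqrt (real (?n t)))"
        using v by (subst ennreal_mult[symmetric]) (auto intro: ennreal_leI)
      from mult_left_mono[OF this, of "\<integral>\<^sup>+\<omega>. ennreal \<bar>gap (?n t) \<omega>\<bar> \<partial>M"]
      show ?case by (simp add: ac_simps)
    qed
  qed auto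
qed

lemma integrable_copy:
  fixes h :: "nat \<Rightarrow> real"
  assumes "k \<ge> 1" "integrable M (\<lambda>\<omega>. h (\<xi> \<omega>))"
  shows "integrable M (\<lambda>\<omega>. h (\<xi>s k \<omega>))"
proof -
  have [measurable]: "(\<lambda>\<omega>. h (\<xi>s k \<omega>)) \<in> borel_measurable M"
    using assms(1) by (rule measurable_fun_copy[where f="\<lambda>x y. h x"]) simp
  have "integrable (distr M borel (\<lambda>\<omega>. h (\<xi> \<omega>))) (\<lambda>x. x)"
    using assms by (subst integrable_distr_eq) auto
  also have "distr M borel (\<lambda>\<omega>. h (\<xi> \<omega>)) = distr M borel (\<lambda>\<omega>. h (\<xi>s k \<omega>))"
    using distr_copy[OF assms(1), of "\<lambda>x y. h x" borel] by simp
  finally show ?thesis by (subst (asm) integrable_distr_eq) auto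
qed

lemma expectation_copy:
  fixes h :: "nat \<Rightarrow> real"
  assumes "k \<ge> 1"
  shows "expectation (\<lambda>\<omega>. h (\<xi>s k \<omega>)) = expectation (\<lambda>\<omega>. h (\<xi> \<omega>))"
proof -
  have [measurable]: "(\<lambda>\<omega>. h (\<xi>s k \<omega>)) \<in> borel_measurable M"
    using assms(1) by (rule measurable_fun_copy[where f="\<lambda>x y. h x"]) simp
  have "expectation (\<lambda>\<omega>. h (\<xi>s k \<omega>)) = integral\<^sup>L (distr M borel (\<lambda>\<omega>. h (\<xi>s k \<omega>))) (\<lambda>x. x)"
    by (subst integral_distr) auto
  also have "\<dots> = integral\<^sup>L (distr M borel (\<lambda>\<omega>. h (\<xi> \<omega>))) (\<lambda>x. x)"
    using distr_copy[OF assms(1), of "\<lambda>x y. h x" borel] by simp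
  also have "\<dots> = expectation (\<lambda>\<omega>. h (\<xi> \<omega>))"
    by (subst integral_distr) auto
  finally show ?thesis .
qed

text \<open>A constant \<open>\<xi>\<close> would not be divisible by any prime larger than itself.\<close>

lemma variance_ln_pos:
  assumes log_xi: "integrable M (\<lambda>\<omega>. ln (real (\<xi> \<omega>)))"
    and log2_xi: "integrable M (\<lambda>\<omega>. (ln (real (\<xi> \<omega>)))\<^sup>2)"
    and prime_pos: "\<And>p. prime p \<Longrightarrow> measure M {\<omega> \<in> space M. multiplicity p (\<xi> \<omega>) > 0} > 0"
  shows "0 < variance (\<lambda>\<omega>. ln (real (\<xi> \<omega>)))"
proof (rule ccontr)
  define \<mu> where "\<mu> = expectation (\<lambda>\<omega>. ln (real (\<xi> \<omega>)))"
  assume "\<not> 0 < variance (\<lambda>\<omega>. ln (real (\<xi> \<omega>)))"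
  moreover have "0 \<le> variance (\<lambda>\<omega>. ln (real (\<xi> \<omega>)))" by (rule variance_positive)
  ultimately have "expectation (\<lambda>\<omega>. (ln (real (\<xi> \<omega>)) - \<mu>)\<^sup>2) = 0" by (simp add: \<mu>_def)
  moreover have "integrable M (\<lambda>\<omega>. (ln (real (\<xi> \<omega>)) - \<mu>)\<^sup>2)"
    using log_xi log2_xi by (simp add: power2_diff)
  ultimately have "AE \<omega> in M. (ln (real (\<xi> \<omega>)) - \<mu>)\<^sup>2 = 0"
    by (subst (asm) integral_nonneg_eq_0_iff_AE) auto
  then have ae: "AE \<omega> in M. ln (real (\<xi> \<omega>)) = \<mu>" by simp
  obtain b :: nat where b: "exp \<mu> \<le> real b" using real_arch_simple by blast
  obtain p where p: "prime p" "p > b" using bigger_prime by blast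
  have "AE \<omega> in M. \<not> multiplicity p (\<xi> \<omega>) > 0"
    using ae AE_space
  proof eventually_elim
    case (elim \<omega>)
    then have "real (\<xi> \<omega>) = exp \<mu>" using generic_pos[of \<omega>] by (metis exp_ln of_nat_0_less_iff)
    then have "\<xi> \<omega> < p" using b p by linarith
    then have "\<not> p dvd \<xi> \<omega>" using generic_pos[of \<omega>] elim by (auto dest: dvd_imp_le)
    then show ?case by (simp add: not_dvd_imp_multiplicity_0)
  qed
  then have "measure M {\<omega> \<in> space M. multiplicity p (\<xi> \<omega>) > 0} = 0"
    by (subst prob_eq_0) auto
  with prime_pos[OF p(1)] show False by simp
qed

end

section \<open>Finite-dimensional limit of the least common multiple\<close>

text \<open>The process differs from the centred and rescaled sums of \<open>ln \<xi>\<^sub>k\<close> by the gap, which is small in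
  mean, and by the rounding error between \<open>\<lfloor>t u\<rfloor>\<close> and \<open>t u\<close>, which costs at most \<open>\<bar>\<mu>\<bar>\<close> before
  rescaling. Markov's inequality turns this into closeness in probability.\<close>

theorem theorem7:
  fixes M :: "'a measure" and \<xi> \<eta> :: "'a \<Rightarrow> nat" and \<xi>s \<eta>s :: "nat \<Rightarrow> 'a \<Rightarrow> nat"
    and N :: "'b measure" and W :: "real \<Rightarrow> 'b \<Rightarrow> real"
  assumes "prob_space M"
    and generic: "(\<lambda>\<omega>. (\<xi> \<omega>, \<eta> \<omega>)) \<in> M \<rightarrow>\<^sub>M posnat2"
    and indep: "prob_space.indep_vars M (\<lambda>_. posnat2) (\<lambda>k \<omega>. (\<xi>s k \<omega>, \<eta>s k \<omega>)) {1..}"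
    and copies: "\<And>k. k \<ge> 1 \<Longrightarrow>
          distr M posnat2 (\<lambda>\<omega>. (\<xi>s k \<omega>, \<eta>s k \<omega>)) = distr M posnat2 (\<lambda>\<omega>. (\<xi> \<omega>, \<eta> \<omega>))"
    and log2_xi: "integrable M (\<lambda>\<omega>. (ln (real (\<xi> \<omega>)))\<^sup>2)"
    and log_eta: "integrable M (\<lambda>\<omega>. ln (real (\<eta> \<omega>)))"
    and prime_pos: "\<And>p. prime p \<Longrightarrow> measure M {\<omega> \<in> space M. multiplicity p (\<xi> \<omega>) > 0} > 0"
    and excess_sq: "(\<Sum>\<^sub>\<infinity>p\<in>{p. prime p}.
          (\<integral>\<^sup>+\<omega>. ennreal ((excess p \<xi> \<eta> \<omega>)\<^sup>2) \<partial>M) * ennreal (ln (real p))) < \<infinity>"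
    and excess_P2: "(\<lambda>n. (\<Sum>\<^sub>\<infinity>p\<in>primes2 M \<xi> n.
          (\<integral>\<^sup>+\<omega>. ennreal (excess p \<xi> \<eta> \<omega>) \<partial>M) * ennreal (ln (real p)))
            / ennreal (real n powr (- 1 / 2))) \<longlonglongrightarrow> 0"
    and BM: "standard_brownian_motion N W"
  defines "\<mu> \<equiv> prob_space.expectation M (\<lambda>\<omega>. ln (real (\<xi> \<omega>)))"
    and "\<sigma> \<equiv> sqrt (prob_space.variance M (\<lambda>\<omega>. ln (real (\<xi> \<omega>))))"
  shows "integrable M (\<lambda>\<omega>. ln (real (\<xi> \<omega>))) \<and>
    (\<forall>u :: real ^ 'n. (\<forall>i. 0 \<le> u $ i) \<longrightarrow>
       weakly_converges
         (\<lambda>t::real. fdd M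
            (\<lambda>v \<omega>. (ln (real (L_lcm \<xi>s \<eta>s (nat \<lfloor>t * v\<rfloor>) \<omega>)) - \<mu> * t * v) / t powr (1 / 2)) u)
         (fdd N (\<lambda>v \<omega>. \<sigma> * W v \<omega>) u) at_top)"
proof (intro conjI allI impI)
  interpret iid_pairs M \<xi> \<eta> \<xi>s \<eta>s
    unfolding iid_pairs_def iid_pairs_axioms_def using assms(1) generic indep copies by blast
  interpret N: prob_space N using BM by (simp add: standard_brownian_motion_def)
  have [measurable]: "(\<lambda>\<omega>. ln (real (\<xi> \<omega>))) \<in> borel_measurable M" by measurable
  show log_xi: "integrable M (\<lambda>\<omega>. ln (real (\<xi> \<omega>)))"
    by (rule square_integrable_imp_integrable[OF _ log2_xi]) measurable
  fix u :: "real ^ 'n" assume "\<forall>i. 0 \<le> u $ i"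
  then have u: "0 \<le> u $ i" for i by simp
  have var_pos: "0 < variance (\<lambda>\<omega>. ln (real (\<xi> \<omega>)))"
    by (rule variance_ln_pos[OF log_xi log2_xi prime_pos])
  then have \<sigma>: "\<sigma> > 0" "\<sigma>\<^sup>2 = expectation (\<lambda>\<omega>. (ln (real (\<xi> \<omega>)) - \<mu>)\<^sup>2)"
    by (simp_all add: \<sigma>_def \<mu>_def)
  define X where "X k \<omega> = ln (real (\<xi>s k \<omega>)) - \<mu>" for k \<omega>
  have Xm [measurable]: "X k \<in> borel_measurable M" if "k \<ge> 1" for k
    unfolding X_def[abs_def] using that by measurable
  have limX: "weakly_converges
     (\<lambda>t::real. fdd M (\<lambda>v \<omega>. (\<Sum>k\<in>{1..nat \<lfloor>t * v\<rfloor>}. X k \<omega>) / sqrt t) u)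
     (fdd N (\<lambda>v \<omega>. \<sigma> * W v \<omega>) u) at_top"
  proof (rule iid_sums_fdd_converge[OF prob_space_axioms _ _ _ _ _ \<sigma>(1) BM u])
    have "indep_vars (\<lambda>_. borel) (\<lambda>k \<omega>. ln (real (fst (\<xi>s k \<omega>, \<eta>s k \<omega>))) - \<mu>) {1..}"
      by (rule indep_vars_compose2[OF indep, where Y="\<lambda>_ z. ln (real (fst z)) - \<mu>"]) simp
    then show "indep_vars (\<lambda>_. borel) X {1..}"
      by (simp add: X_def[abs_def])
    fix k :: nat assume k: "k \<ge> 1"
    show "distr M borel (X k) = distr M borel (\<lambda>\<omega>. ln (real (\<xi> \<omega>)) - \<mu>)"
      unfolding X_def[abs_def] by (rule distr_copy[OF k, of "\<lambda>x y. ln (real x) - \<mu>"]) simp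
    show "expectation (X k) = 0"
      unfolding X_def[abs_def] expectation_copy[OF k, of "\<lambda>x. ln (real x) - \<mu>"]
      using log_xi by (simp add: prob_space \<mu>_def)
    show "integrable M (\<lambda>\<omega>. (X k \<omega>)\<^sup>2)"
      unfolding X_def
      by (rule integrable_copy[OF k, of "\<lambda>x. (ln (real x) - \<mu>)\<^sup>2"]) (use log_xi log2_xi in \<open>simp add: power2_diff\<close>)
    show "expectation (\<lambda>\<omega>. (X k \<omega>)\<^sup>2) = \<sigma>\<^sup>2"
      unfolding X_def \<sigma>(2) by (rule expectation_copy[OF k])
  qed
  define V where "V t \<omega> = (\<chi> i. (\<Sum>k\<in>{1..nat \<lfloor>t * (u $ i)\<rfloor>}. X k \<omega>) / sqrt t)" for t \<omega>
  define Y where "Y t \<omega> = (\<chi> i. (ln (real (L_lcm \<xi>s \<eta>s (nat \<lfloor>t * (u $ i)\<rfloor>) \<omega>)) - \<mu> * t * (u $ i)) / t powr (1 / 2))" for t \<omega>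
  have Vm: "V t \<in> borel_measurable M" for t
    unfolding V_def[abs_def] by (intro borel_measurable_vec_lambda borel_measurable_divide borel_measurable_sum Xm) auto
  have Ym: "Y t \<in> borel_measurable M" for t
    unfolding Y_def[abs_def] by measurable
  have Wm: "(\<lambda>\<omega>. \<chi> i. \<sigma> * W (u $ i) \<omega>) \<in> borel_measurable N"
    using BM u by (intro borel_measurable_vec_lambda borel_measurable_times) (auto simp: standard_brownian_motion_def)
  have gap: "\<bar>Y t \<omega> $ i - V t \<omega> $ i\<bar> \<le> \<bar>gap (nat \<lfloor>t * (u $ i)\<rfloor>) \<omega>\<bar> * (1 / sqrt t) + \<bar>\<mu>\<bar> * (1 / sqrt t)"
    if t: "t > 0" and \<omega>: "\<omega> \<in> space M" for t \<omega> i
  proof -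
    define n where "n = nat \<lfloor>t * (u $ i)\<rfloor>"
    have n: "\<bar>real n - t * (u $ i)\<bar> \<le> 1"
      using t u[of i] by (simp add: n_def of_nat_nat) linarith
    have "ln (real (Pi_walk \<xi>s n \<omega>)) = (\<Sum>k\<in>{1..n}. X k \<omega>) + real n * \<mu>"
      using \<omega> by (subst ln_Pi_walk) (auto simp: X_def sum_subtractf intro: copy_pos)
    then have "ln (real (L_lcm \<xi>s \<eta>s n \<omega>)) - \<mu> * t * (u $ i) - (\<Sum>k\<in>{1..n}. X k \<omega>)
      = gap n \<omega> + \<mu> * (real n - t * (u $ i))"
      by (simp add: gap_def algebra_simps)
    moreover have "Y t \<omega> $ i - V t \<omega> $ i
      = (ln (real (L_lcm \<xi>s \<eta>s n \<omega>)) - \<mu> * t * (u $ i) - (\<Sum>k\<in>{1..n}. X k \<omega>)) * (1 / sqrt t)"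
      using t by (simp add: Y_def V_def n_def powr_half_sqrt diff_divide_distrib)
    ultimately have "\<bar>Y t \<omega> $ i - V t \<omega> $ i\<bar> = \<bar>gap n \<omega> + \<mu> * (real n - t * (u $ i))\<bar> * (1 / sqrt t)"
      using t by (simp add: abs_mult)
    also have "\<dots> \<le> (\<bar>gap n \<omega>\<bar> + \<bar>\<mu>\<bar>) * (1 / sqrt t)"
    proof (rule mult_right_mono)
      have "\<bar>\<mu> * (real n - t * (u $ i))\<bar> \<le> \<bar>\<mu>\<bar> * 1"
        unfolding abs_mult using n by (intro mult_left_mono) auto
      then show "\<bar>gap n \<omega> + \<mu> * (real n - t * (u $ i))\<bar> \<le> \<bar>gap n \<omega>\<bar> + \<bar>\<mu>\<bar>" by linarith
    qed (use t in auto)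
    finally show ?thesis by (simp add: n_def distrib_right add_divide_distrib)
  qed
  define r where "r t = (\<Sum>i\<in>UNIV. (\<integral>\<^sup>+\<omega>. ennreal \<bar>gap (nat \<lfloor>t * (u $ i)\<rfloor>) \<omega>\<bar> \<partial>M) * ennreal (1 / sqrt t)
      + ennreal (\<bar>\<mu>\<bar> * (1 / sqrt t)))" for t
  have dist_le: "(\<integral>\<^sup>+\<omega>. ennreal (dist (Y t \<omega>) (V t \<omega>)) \<partial>M) \<le> r t" if t: "t > 0" for t
  proof -
    have "(\<integral>\<^sup>+\<omega>. ennreal (dist (Y t \<omega>) (V t \<omega>)) \<partial>M)
      \<le> (\<integral>\<^sup>+\<omega>. (\<Sum>i\<in>UNIV. ennreal \<bar>gap (nat \<lfloor>t * (u $ i)\<rfloor>) \<omega>\<bar> * ennreal (1 / sqrt t) + ennreal (\<bar>\<mu>\<bar> * (1 / sqrt t))) \<partial>M)"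
    proof (rule nn_integral_mono)
      fix \<omega> assume \<omega>: "\<omega> \<in> space M"
      have "dist (Y t \<omega>) (V t \<omega>) \<le> (\<Sum>i\<in>UNIV. \<bar>(Y t \<omega> - V t \<omega>) $ i\<bar>)"
        unfolding dist_norm by (rule norm_le_l1_cart)
      also have "\<dots> \<le> (\<Sum>i\<in>UNIV. \<bar>gap (nat \<lfloor>t * (u $ i)\<rfloor>) \<omega>\<bar> * (1 / sqrt t) + \<bar>\<mu>\<bar> * (1 / sqrt t))"
        using gap[OF t \<omega>] by (intro sum_mono) simp
      finally have "ennreal (dist (Y t \<omega>) (V t \<omega>))
         \<le> ennreal (\<Sum>i\<in>UNIV. \<bar>gap (nat \<lfloor>t * (u $ i)\<rfloor>) \<omega>\<bar> * (1 / sqrt t) + \<bar>\<mu>\<bar> * (1 / sqrt t))"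
        by (rule ennreal_leI)
      also have "\<dots> = (\<Sum>i\<in>UNIV. ennreal \<bar>gap (nat \<lfloor>t * (u $ i)\<rfloor>) \<omega>\<bar> * ennreal (1 / sqrt t) + ennreal (\<bar>\<mu>\<bar> * (1 / sqrt t)))"
        using t by (subst sum_ennreal[symmetric]) (auto simp: ennreal_plus ennreal_mult simp del: times_divide_eq_right mult_1_right)
      finally show "ennreal (dist (Y t \<omega>) (V t \<omega>)) \<le> \<dots>" .
    qed
    also have "\<dots> = r t"
      unfolding r_def
      by (subst nn_integral_sum) (auto simp: nn_integral_add nn_integral_multc emeasure_space_1)
    finally show ?thesis .
  qed
  have r_lim: "(r \<longlongrightarrow> 0) at_top"
  proof -
    have sq0: "((\<lambda>t::real. 1 / sqrt t) \<longlongrightarrow> 0) at_top"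
      by (intro real_tendsto_divide_at_top[OF tendsto_const] sqrt_at_top)
    have "(r \<longlongrightarrow> (\<Sum>i\<in>(UNIV :: 'n set). 0 + ennreal (\<bar>\<mu>\<bar> * 0))) at_top"
      unfolding r_def[abs_def]
      by (intro tendsto_sum tendsto_add tendsto_expected_gap_scaled[OF tendsto_expected_gap] log_xi prime_pos
          excess_sq excess_P2 u tendsto_ennrealI tendsto_mult tendsto_const sq0)
    then show ?thesis by simp
  qed
  have "weakly_converges (\<lambda>t. distr M borel (Y t)) (fdd N (\<lambda>v \<omega>. \<sigma> * W v \<omega>) u) at_top"
  proof (rule weakly_converges_perturb[OF prob_space_axioms _ _ Vm Ym])
    show "prob_space (fdd N (\<lambda>v \<omega>. \<sigma> * W v \<omega>) u)"
      unfolding fdd_def using Wm by (rule N.prob_space_distr)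
    show "sets (fdd N (\<lambda>v \<omega>. \<sigma> * W v \<omega>) u) = sets borel" by (simp add: fdd_def)
    show "weakly_converges (\<lambda>t. distr M borel (V t)) (fdd N (\<lambda>v \<omega>. \<sigma> * W v \<omega>) u) at_top"
      using limX by (simp add: fdd_def V_def[abs_def])
    fix \<delta> :: real assume "\<delta> > 0"
    let ?A = "\<lambda>t. {\<omega> \<in> space M. \<delta> \<le> dist (Y t \<omega>) (V t \<omega>)}"
    have lim: "((\<lambda>t. ennreal (1 / \<delta>) * r t) \<longlongrightarrow> 0) at_top"
      using ennreal_tendsto_cmult[OF _ r_lim, of "ennreal (1 / \<delta>)"] by simp
    have "((\<lambda>t. ennreal (measure M (?A t))) \<longlongrightarrow> ennreal 0) at_top"
      unfolding ennreal_0
    proof (rule tendsto_sandwich[OF _ _ tendsto_const lim])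
      show "eventually (\<lambda>t. ennreal (measure M (?A t)) \<le> ennreal (1 / \<delta>) * r t) at_top"
        using eventually_gt_at_top[of 0]
      proof eventually_elim
        case (elim t)
        note [measurable] = Vm[of t] Ym[of t]
        have "?A t = {\<omega> \<in> space M. 1 \<le> ennreal (1 / \<delta>) * ennreal (dist (Y t \<omega>) (V t \<omega>))}"
          using \<open>\<delta> > 0\<close> by (auto simp: ennreal_mult[symmetric] field_simps simp flip: ennreal_1)
        then have "emeasure M (?A t) \<le> ennreal (1 / \<delta>) * (\<integral>\<^sup>+\<omega>. ennreal (dist (Y t \<omega>) (V t \<omega>)) * indicator (space M) \<omega> \<partial>M)"
          using nn_integral_Markov_inequality[of "\<lambda>\<omega>. ennreal (dist (Y t \<omega>) (V t \<omega>))" "space M" M "ennreal (1 / \<delta>)"]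
          by simp
        also have "(\<integral>\<^sup>+\<omega>. ennreal (dist (Y t \<omega>) (V t \<omega>)) * indicator (space M) \<omega> \<partial>M)
           = (\<integral>\<^sup>+\<omega>. ennreal (dist (Y t \<omega>) (V t \<omega>)) \<partial>M)"
          by (intro nn_integral_cong) simp
        also have "ennreal (1 / \<delta>) * \<dots> \<le> ennreal (1 / \<delta>) * r t"
          using dist_le[OF elim] by (intro mult_left_mono) auto
        finally show ?case by (simp add: emeasure_eq_measure)
      qed
    qed auto
    then show "((\<lambda>t. measure M (?A t)) \<longlongrightarrow> 0) at_top"
      by (rule tendsto_ennrealD) auto
  qed
  then show "weakly_converges
         (\<lambda>t::real. fdd M
            (\<lambda>v \<omega>. (ln (real (L_lcm \<xi>s \<eta>s (nat \<lfloor>t * v\<rfloor>) \<omega>)) - \<mu> * t * v) / t powr (1 / 2)) u)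
         (fdd N (\<lambda>v \<omega>. \<sigma> * W v \<omega>) u) at_top"
    by (simp add: fdd_def Y_def[abs_def])
qed

end
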